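(* Let $m=\{m_j,\ j\ge 1\}$, $m_j\ge 1$, be the parameter function of a multiset with parameter $0<p<1$. The multiset is divergent, for any $0<p<1$, if $m$ satisfies one of the following conditions: (i) $m\in RT_1$; (ii) $m_j=O(j^\alpha)$ for some $\alpha\in\mathbb{R}$; (iii) $m\in\mathcal{F}(\tfrac{2r}{3}+\epsilon,r;1)$ for some $r>0$ and $0<\epsilon\le\tfrac r3$. The multiset is convergent, for any $0<p<1$, if $m$ satisfies one of the following conditions: (iv) $m\in RT_\rho$ for some $0<\rho<1$; (v) $m\in\mathcal{F}(\tfrac{2r}{3}+\epsilon,r;y)$ for some $r>0$, $0<\epsilon\le\tfrac r3$ and $y>1$; (vi) $m_j\asymp y^jj^{-1}$ for some $y>1$.
   Context: A multiset with parameters $0<p<1$ and $m_j\ge 1$, $j\ge 1$, is the random structure induced by independent random variables $Z_j$, $j\ge 1$, with the negative binomial distribution $NB(m_j,p^j)$, i.e. $\mathbb{P}(Z_j=k)=(1-p^j)^{m_j}\binom{m_j+k-1}{k}p^{jk}$, $k\ge 0$: its counting process $\{\mathbf{K}^{(n)}=(K^{(n)}_1,\dots,K^{(n)}_n),\ n\ge 1\}$ is defined by $\mathcal{L}(\mathbf{K}^{(n)})=\mathcal{L}\big(Z_1,\dots,Z_n\,\big|\,\sum_{j=1}^n jZ_j=n\big)$. The random structure is said to be convergent if for each fixed $l\ge 1$ the law of $(K^{(n)}_1,\dots,K^{(n)}_l)$ converges weakly, as $n\to\infty$, to some probability law on $\mathbb{R}^l$; otherwise it is divergent. For $0\le\rho\le\infty$,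 $RT_\rho$ is the collection of sequences $\{d_n\}$ of nonnegative numbers with $\lim_{n\to\infty}d_n/d_{n+1}=\rho$. For $0<r_1\le r_2$ and $y>0$, $\mathcal{F}(r_1,r_2;y)$ is the set of functions $f=f(j)$, $j\ge1$, such that $\gamma_1y^jj^{r_1-1}\le f(j)\le\gamma_2y^jj^{r_2-1}$ for all $j\ge 1$, with some positive constants $\gamma_1,\gamma_2$. $a_j\asymp b_j$ means that the ratio $a_j/b_j$, $j\ge 1$, is bounded above and below by positive constants. *)

theory Defs
  imports "HOL-Probability.Probability" "HOL-Library.Landau_Symbols"
begin

text \<open>
  The negative binomial law \<open>NB(m, q)\<close> with real shape parameter \<open>m > 0\<close>. In contrast to
  \<open>neg_binomial_pmf\<close>, the shape parameter need not be an integer and \<open>q\<close> is the failure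
  probability; for integer \<open>m\<close> the two agree, see \<open>NB_pmf_of_nat\<close> below.
\<close>

definition NB_pmf :: "real \<Rightarrow> real \<Rightarrow> nat pmf" where
  "NB_pmf m q = embed_pmf (\<lambda>k. (1 - q) powr m * ((m + real k - 1) gchoose k) * q ^ k)"

lemma pmf_NB:
  assumes m: "m > 0" and q: "0 \<le> q" "q < 1"
  shows "pmf (NB_pmf m q) k = (1 - q) powr m * ((m + real k - 1) gchoose k) * q ^ k"
proof -
  define f where "f = (\<lambda>k. (1 - q) powr m * ((m + real k - 1) gchoose k) * q ^ k)"
  have gb: "(m + real k - 1) gchoose k \<ge> 0" for k
    using m by (auto simp: gbinomial_pochhammer' intro!: divide_nonneg_nonneg pochhammer_nonneg)
  have nonneg: "f k \<ge> 0" for k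
    unfolding f_def using gb q by (intro mult_nonneg_nonneg) auto
  have "(\<lambda>n. ((-m) gchoose n) * (-q) ^ n) sums (1 + (-q)) powr (-m)"
    using q by (intro gen_binomial_real) auto
  also have "(\<lambda>n. ((-m) gchoose n) * (-q) ^ n) = (\<lambda>n. ((m + real n - 1) gchoose n) * q ^ n)"
  proof
    fix n
    have "((-1::real) ^ n) * (-q) ^ n = q ^ n"
      by (simp flip: power_mult_distrib)
    then show "((-m) gchoose n) * (-q) ^ n = ((m + real n - 1) gchoose n) * q ^ n"
      by (simp add: gbinomial_minus mult_ac)
  qed
  finally have "(\<lambda>n. (1 - q) powr m * (((m + real n - 1) gchoose n) * q ^ n))
      sums ((1 - q) powr m * (1 + (-q)) powr (-m))"
    by (rule sums_mult)
  moreover have "(1 - q) powr m * (1 + (-q)) powr (-m) = 1"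
    using q by (simp flip: powr_add)
  ultimately have sums: "f sums 1"
    by (simp add: f_def mult.assoc)
  have "(\<integral>\<^sup>+ k. ennreal (f k) \<partial>count_space UNIV) = 1"
    using nonneg sums
    by (simp add: nn_integral_count_space_nat suminf_ennreal2 sums_iff)
  then have "pmf (embed_pmf f) k = f k"
    by (intro pmf_embed_pmf nonneg)
  then show ?thesis
    by (simp add: NB_pmf_def f_def)
qed

lemma NB_pmf_of_nat:
  assumes "n > 0" and "0 \<le> q" "q < 1"
  shows "NB_pmf (real n) q = neg_binomial_pmf n (1 - q)"
proof (rule pmf_eqI)
  fix k
  have "real n + real k - 1 = real (k + n - 1)"
    using assms by (simp add: of_nat_diff)
  then show "pmf (NB_pmf (real n) q) k = pmf (neg_binomial_pmf n (1 - q)) k"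
    using assms by (simp add: pmf_NB pmf_neg_binomial powr_realpow binomial_gbinomial add.commute)
qed

text \<open>
  A sequence of laws of \<open>K\<^sup>(\<^sup>n\<^sup>)\<close> is represented by probability mass functions on
  \<open>nat \<Rightarrow> nat\<close>; only the coordinates \<open>1, \<dots>, n\<close> carry information, all the others being \<open>0\<close>.
  The conditioning event below has positive probability, see \<open>multiset_event_possible\<close>.
\<close>

definition multiset_process :: "(nat \<Rightarrow> real) \<Rightarrow> real \<Rightarrow> nat \<Rightarrow> (nat \<Rightarrow> nat) pmf" where
  "multiset_process m p n =
     cond_pmf (Pi_pmf {1..n} 0 (\<lambda>j. NB_pmf (m j) (p ^ j))) {k. (\<Sum>j=1..n. j * k j) = n}"

lemma multiset_event_possible:
  assumes m: "\<And>j. j \<ge> 1 \<Longrightarrow> m j \<ge> 1" and p: "0 < p" "p < 1"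
  shows "set_pmf (Pi_pmf {1..n} 0 (\<lambda>j. NB_pmf (m j) (p ^ j)))
           \<inter> {k. (\<Sum>j=1..n. j * k j) = n} \<noteq> {}"
proof -
  have pos: "pmf (NB_pmf (m j) (p ^ j)) i > 0" if "j \<ge> 1" for j i
  proof -
    have q: "0 < p ^ j" "p ^ j < 1"
      using p that by (auto simp: power_less_one_iff)
    moreover have "0 < (m j + real i - 1) gchoose i"
      using m[OF that] by (auto simp: gbinomial_pochhammer' intro!: divide_pos_pos pochhammer_pos)
    ultimately show ?thesis
      using m[OF that] by (subst pmf_NB) auto
  qed
  define k where "k = (\<lambda>j. if j = 1 \<and> j \<le> n then n else 0)"
  have "(\<Sum>j=1..n. j * k j) = (\<Sum>j=1..n. if j = 1 then n else 0)"
    by (intro sum.cong) (auto simp: k_def)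
  then have "(\<Sum>j=1..n. j * k j) = n"
    by simp
  moreover have "k \<in> set_pmf (Pi_pmf {1..n} 0 (\<lambda>j. NB_pmf (m j) (p ^ j)))"
    using pos by (force simp: set_Pi_pmf PiE_dflt_def k_def set_pmf_iff less_le)
  ultimately show ?thesis
    by blast
qed

text \<open>
  \<open>\<real>\<^sup>l\<close> is the space of functions on \<open>{1..l}\<close> (extended by \<open>undefined\<close>), with
  \<open>product_topology (\<lambda>_. euclideanreal) {1..l}\<close> as its topology and
  \<open>\<Pi>\<^sub>M j\<in>{1..l}. borel\<close> as its measurable space.
\<close>

definition weakly_converges ::
    "nat \<Rightarrow> (nat \<Rightarrow> (nat \<Rightarrow> real) measure) \<Rightarrow> (nat \<Rightarrow> real) measure \<Rightarrow> bool" where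
  "weakly_converges l \<mu> \<nu> \<longleftrightarrow>
     (\<forall>f. continuous_map (product_topology (\<lambda>_. euclideanreal) {1..l}) euclideanreal f \<and>
          bounded (f ` (\<Pi>\<^sub>E j\<in>{1..l}. UNIV)) \<longrightarrow>
          (\<lambda>n. \<integral>x. f x \<partial>\<mu> n) \<longlonglongrightarrow> (\<integral>x. f x \<partial>\<nu>))"

text \<open>The test functions are measurable, so that the integrals above are not vacuous.\<close>

lemma continuous_map_measurable_PiM:
  fixes l :: nat
  assumes "continuous_map (product_topology (\<lambda>_. euclideanreal) {1..l}) euclideanreal f"
  shows "f \<in> borel_measurable (\<Pi>\<^sub>M j\<in>{1..l}. borel)"
proof -
  let ?r = "\<lambda>x::nat \<Rightarrow> real. restrict x {1..l}"
  let ?e = "\<lambda>(x::nat \<Rightarrow> real) j. if j \<in> {1..l} then x j else 0"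
  have "continuous_map (product_topology (\<lambda>_. euclideanreal) UNIV)
          (product_topology (\<lambda>_. euclideanreal) {1..l}) ?r"
    by (auto simp: continuous_map_componentwise intro: continuous_map_product_projection cong: if_cong)
  then have "continuous_map (product_topology (\<lambda>_. euclideanreal) UNIV) euclideanreal (f \<circ> ?r)"
    using assms by (rule continuous_map_compose)
  then have "continuous_on UNIV (f \<circ> ?r)"
    unfolding euclidean_product_topology continuous_map_iff_continuous2 .
  then have "f \<circ> ?r \<in> borel_measurable borel"
    by (rule borel_measurable_continuous_onI)
  then have 1: "f \<circ> ?r \<in> borel_measurable (\<Pi>\<^sub>M j\<in>UNIV. borel)"
    by (simp cong: measurable_cong_sets add: sets_PiM_equal_borel)
  have 2: "?e \<in> measurable (\<Pi>\<^sub>M j\<in>{1..l}. borel) (\<Pi>\<^sub>M j\<in>UNIV. borel)"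
  proof (rule measurable_PiM_single')
    fix i :: nat
    show "(\<lambda>x. ?e x i) \<in> borel_measurable (\<Pi>\<^sub>M j\<in>{1..l}. borel)"
      by (cases "i \<in> {1..l}") auto
  qed auto
  have "(f \<circ> ?r) \<circ> ?e \<in> borel_measurable (\<Pi>\<^sub>M j\<in>{1..l}. borel)"
    using 2 1 by (rule measurable_comp)
  moreover have "((f \<circ> ?r) \<circ> ?e) x = f x" if "x \<in> space (\<Pi>\<^sub>M j\<in>{1..l}. borel)" for x
  proof -
    have "?r (?e x) = x"
      using that by (auto simp: space_PiM PiE_def extensional_def restrict_def)
    then show ?thesis by simp
  qed
  ultimately show ?thesis
    by (subst measurable_cong[of _ f "(f \<circ> ?r) \<circ> ?e"]) auto
qed

definition initial_law :: "(nat \<Rightarrow> nat) pmf \<Rightarrow> nat \<Rightarrow> (nat \<Rightarrow> real) measure" where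
  "initial_law K l =
     distr (measure_pmf K) (\<Pi>\<^sub>M j\<in>{1..l}. borel) (\<lambda>k. \<lambda>j\<in>{1..l}. real (k j))"

definition convergent_structure :: "(nat \<Rightarrow> (nat \<Rightarrow> nat) pmf) \<Rightarrow> bool" where
  "convergent_structure K \<longleftrightarrow>
     (\<forall>l\<ge>1. \<exists>\<nu>. prob_space \<nu> \<and> sets \<nu> = sets (\<Pi>\<^sub>M j\<in>{1..l}. (borel :: real measure)) \<and>
        weakly_converges l (\<lambda>n. initial_law (K n) l) \<nu>)"

definition divergent_structure :: "(nat \<Rightarrow> (nat \<Rightarrow> nat) pmf) \<Rightarrow> bool" where
  "divergent_structure K \<longleftrightarrow> \<not> convergent_structure K"

text \<open>All sequences below are indexed by \<open>j \<ge> 1\<close>; the value at \<open>0\<close> is irrelevant.\<close>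

definition RT :: "ereal \<Rightarrow> (nat \<Rightarrow> real) set" where
  "RT \<rho> = {d. (\<forall>n\<ge>1. d n \<ge> 0) \<and> (\<forall>\<^sub>F n in sequentially. d n \<noteq> 0) \<and>
              (\<lambda>n. ereal (d n / d (Suc n))) \<longlonglongrightarrow> \<rho>}"

definition \<F> :: "real \<Rightarrow> real \<Rightarrow> real \<Rightarrow> (nat \<Rightarrow> real) set" where
  "\<F> r1 r2 y = {f. \<exists>\<gamma>1>0. \<exists>\<gamma>2>0. \<forall>j\<ge>1.
      \<gamma>1 * y ^ j * real j powr (r1 - 1) \<le> f j \<and> f j \<le> \<gamma>2 * y ^ j * real j powr (r2 - 1)}"

definition same_order :: "(nat \<Rightarrow> real) \<Rightarrow> (nat \<Rightarrow> real) \<Rightarrow> bool"  (infix "\<asymp>" 50) where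
  "a \<asymp> b \<longleftrightarrow> (\<exists>c>0. \<exists>C>0. \<forall>j\<ge>1. c \<le> a j / b j \<and> a j / b j \<le> C)"

end

theory Submission
  imports Defs
    "HOL-Computational_Algebra.Formal_Laurent_Series"
    "HOL-Real_Asymp.Real_Asymp"
begin

text \<open>
  The parameter \<open>p\<close> cancels in the conditional law. With \<open>C l = \<Prod>\<^sub>j\<^sub>>\<^sub>l (1 - x\<^sup>j)\<^sup>-\<^sup>m\<^sup>(\<^sup>j\<^sup>)\<close> and \<open>c\<close> the
  coefficients of \<open>C 0\<close>, the probability that \<open>K\<^sub>j = x\<^sub>j\<close> for all \<open>j \<le> l\<close> is a product of
  binomial coefficients times the quotient of the coefficient of \<open>C l\<close> at \<open>n - \<Sum> j x\<^sub>j\<close> by \<open>c\<^sub>n\<close>.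

  Divergence: if the law of \<open>K\<^sub>1\<close> were tight, then, since \<open>m\<^sub>1 \<ge> 1\<close>, the partial sums of the
  coefficients of \<open>C 1\<close>, which are at most \<open>c\<^sub>n\<close>, would grow exponentially. In cases (i)-(iii)
  the radius of convergence of \<open>C 0\<close> is at least 1, so this is impossible.

  Convergence: if \<open>c\<^sub>n / c\<^sub>n\<^sub>+\<^sub>1\<close> tends to some \<open>\<rho> < 1\<close>, Tannery's theorem, applied to one factor
  \<open>(1 - x\<^sup>j)\<^sup>m\<^sup>(\<^sup>j\<^sup>)\<close> at a time, shows that the initial laws converge pointwise to the product of the
  laws \<open>NB(m\<^sub>j, \<rho>\<^sup>j)\<close>. The ratio limit comes from the recurrence \<open>n c\<^sub>n = \<Sum> b\<^sub>k c\<^sub>n\<^sub>-\<^sub>k\<close> with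
  \<open>b\<^sub>k = \<Sum>\<^sub>d\<^sub>|\<^sub>k d m\<^sub>d\<close>. After rescaling to \<open>\<rho> = 1\<close>, it holds if \<open>b\<^sub>k\<^sub>+\<^sub>1 / b\<^sub>k\<close> tends to 1, which gives
  (iv). For (v) and (vi), \<open>b\<close> has a minorant \<open>b'\<close> of the form \<open>\<gamma> k\<^sup>s\<close>, so that \<open>c\<close> is the convolution
  of the regular sequence \<open>u\<close> generated by \<open>b'\<close> with a nonnegative sequence \<open>h\<close> generated by \<open>b - b'\<close>;
  as \<open>b\<^sub>k = o(k u\<^sub>k)\<close>, the recurrence for \<open>h\<close> gives \<open>h\<^sub>n = o(c\<^sub>n)\<close>, and \<open>c\<close> inherits the regularity of \<open>u\<close>.
\<close>

section \<open>Sequences generated by an Euler-type recurrence\<close>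

text \<open>The easy half of Toeplitz's theorem: vanishing columns remove any finite head of
  \<open>x\<close>, and row sums at most 1 keep the rest below the supremum of the tail of
  \<open>x\<close>. The two ratio lemmas for \<open>euler_coeff\<close> write their errors as such
  averages.\<close>

lemma toeplitz_null:
  fixes w :: "nat \<Rightarrow> nat \<Rightarrow> real" and x :: "nat \<Rightarrow> real"
  assumes nonneg: "\<And>n i. i \<le> n \<Longrightarrow> 0 \<le> w n i"
    and le1: "\<And>n. (\<Sum>i\<le>n. w n i) \<le> 1"
    and w0: "\<And>i. (\<lambda>n. w n i) \<longlonglongrightarrow> 0"
    and x0: "x \<longlonglongrightarrow> 0"
  shows "(\<lambda>n. \<Sum>i\<le>n. w n i * x i) \<longlonglongrightarrow> 0"
proof (rule LIMSEQ_I)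
  fix e :: real assume "e > 0"
  then obtain K where K: "\<And>i. i \<ge> K \<Longrightarrow> \<bar>x i\<bar> < e / 2"
    using LIMSEQ_D[OF x0, of "e / 2"] by auto
  have "(\<lambda>n. \<Sum>i<K. w n i * x i) \<longlonglongrightarrow> (\<Sum>i<K. 0 * x i)"
    by (intro tendsto_intros w0)
  then have "(\<lambda>n. \<Sum>i<K. w n i * x i) \<longlonglongrightarrow> 0" by simp
  from LIMSEQ_D[OF this, of "e / 2"] \<open>e > 0\<close>
  obtain N where N: "\<And>n. n \<ge> N \<Longrightarrow> \<bar>\<Sum>i<K. w n i * x i\<bar> < e / 2" by auto
  have "norm ((\<Sum>i\<le>n. w n i * x i) - 0) < e" if n: "n \<ge> max N K" for n
  proof -
    have "{..n} = {..<K} \<union> {K..n}" "{..<K} \<inter> {K..n} = {}" using n by auto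
    then have "(\<Sum>i\<le>n. w n i * x i) = (\<Sum>i<K. w n i * x i) + (\<Sum>i=K..n. w n i * x i)"
      by (simp add: sum.union_disjoint)
    moreover have "\<bar>\<Sum>i=K..n. w n i * x i\<bar> \<le> e / 2"
    proof -
      have "\<bar>\<Sum>i=K..n. w n i * x i\<bar> \<le> (\<Sum>i=K..n. w n i * (e / 2))"
      proof (intro order_trans[OF sum_abs] sum_mono)
        fix i assume i: "i \<in> {K..n}"
        have "\<bar>w n i * x i\<bar> = w n i * \<bar>x i\<bar>" using nonneg[of i n] i by (simp add: abs_mult)
        also have "\<dots> \<le> w n i * (e / 2)"
          using K[of i] i nonneg[of i n] by (intro mult_left_mono) auto
        finally show "\<bar>w n i * x i\<bar> \<le> w n i * (e / 2)" .
      qed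
      also have "\<dots> \<le> (\<Sum>i\<le>n. w n i * (e / 2))"
        using nonneg \<open>e > 0\<close> by (intro sum_mono2) auto
      also have "\<dots> = (\<Sum>i\<le>n. w n i) * (e / 2)" by (simp add: sum_distrib_right)
      also have "\<dots> \<le> 1 * (e / 2)" using le1 \<open>e > 0\<close> by (intro mult_right_mono) auto
      finally show ?thesis by simp
    qed
    ultimately show ?thesis using N[of n] n by auto
  qed
  then show "\<exists>no. \<forall>n\<ge>no. norm ((\<Sum>i\<le>n. w n i * x i) - 0) < e" by blast
qed

text \<open>The coefficients of exp (\<Sum> b k x^k / k), k \<ge> 1, given through the recurrence
  that logarithmic differentiation yields.\<close>

fun euler_coeff :: "(nat \<Rightarrow> real) \<Rightarrow> nat \<Rightarrow> real" where
  "euler_coeff b 0 = 1"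
| "euler_coeff b (Suc n) = (\<Sum>i\<le>n. b (Suc i) * euler_coeff b (n - i)) / real (Suc n)"

lemma euler_coeff_rec:
  "real (Suc n) * euler_coeff b (Suc n) = (\<Sum>i\<le>n. b (Suc i) * euler_coeff b (n - i))"
  by simp

declare euler_coeff.simps(2) [simp del]

lemma euler_coeff_unique:
  assumes "c 0 = 1"
    and "\<And>n. real (Suc n) * c (Suc n) = (\<Sum>i\<le>n. b (Suc i) * c (n - i))"
  shows "c n = euler_coeff b n"
proof (induction n rule: less_induct)
  case (less n)
  show ?case
  proof (cases n)
    case (Suc k)
    have "real (Suc k) * c (Suc k) = (\<Sum>i\<le>k. b (Suc i) * euler_coeff b (k - i))"
      unfolding assms(2) using less Suc by (intro sum.cong) auto
    also have "\<dots> = real (Suc k) * euler_coeff b (Suc k)" by (simp only: euler_coeff_rec)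
    finally show ?thesis using Suc by simp
  qed (use assms in simp)
qed

lemma euler_coeff_nonneg:
  assumes "\<And>k. k \<ge> 1 \<Longrightarrow> b k \<ge> 0"
  shows "euler_coeff b n \<ge> 0"
proof (induction n rule: less_induct)
  case (less n)
  show ?case
  proof (cases n)
    case (Suc k)
    then show ?thesis using less assms
      by (auto simp: euler_coeff.simps(2) intro!: divide_nonneg_pos sum_nonneg mult_nonneg_nonneg)
  qed auto
qed

text \<open>The single summand \<open>i = n\<close> of the recurrence, whose other factor is
  \<open>euler_coeff b 0 = 1\<close>, already gives the bound.\<close>

lemma euler_coeff_ge:
  assumes "\<And>k. k \<ge> 1 \<Longrightarrow> b k \<ge> 0"
  shows "b (Suc n) / real (Suc n) \<le> euler_coeff b (Suc n)"
proof -
  have "b (Suc n) * euler_coeff b (n - n) \<le> (\<Sum>i\<le>n. b (Suc i) * euler_coeff b (n - i))"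
    using assms euler_coeff_nonneg[OF assms] by (intro member_le_sum) auto
  then show ?thesis by (simp add: euler_coeff.simps(2) divide_right_mono del: of_nat_Suc)
qed

lemma euler_coeff_pos:
  assumes "\<And>k. k \<ge> 1 \<Longrightarrow> b k > 0"
  shows "euler_coeff b n > 0"
proof (cases n)
  case (Suc k)
  have "0 < b (Suc k) / real (Suc k)" using assms by simp
  also have "\<dots> \<le> euler_coeff b n"
    unfolding Suc using assms by (intro euler_coeff_ge) (auto intro: less_imp_le)
  finally show ?thesis .
qed auto

text \<open>Substitution of x times the variable in the generating function. With x = \<rho> it
  moves a ratio limit 1 / \<rho> to 1.\<close>

lemma euler_coeff_scale: "euler_coeff (\<lambda>k. b k * x ^ k) n = euler_coeff b n * x ^ n"
proof (rule euler_coeff_unique[symmetric])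
  fix n
  have "real (Suc n) * (euler_coeff b (Suc n) * x ^ Suc n) =
      (\<Sum>i\<le>n. b (Suc i) * euler_coeff b (n - i)) * x ^ Suc n"
    by (simp only: euler_coeff_rec[symmetric] mult.assoc)
  also have "\<dots> = (\<Sum>i\<le>n. b (Suc i) * x ^ Suc i * (euler_coeff b (n - i) * x ^ (n - i)))"
    unfolding sum_distrib_right
  proof (intro sum.cong refl)
    fix i assume "i \<in> {..n}"
    then have "x ^ Suc n = x ^ Suc i * x ^ (n - i)" by (simp flip: power_add)
    then show "b (Suc i) * euler_coeff b (n - i) * x ^ Suc n =
        b (Suc i) * x ^ Suc i * (euler_coeff b (n - i) * x ^ (n - i))" by simp
  qed
  finally show "real (Suc n) * (euler_coeff b (Suc n) * x ^ Suc n) =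
      (\<Sum>i\<le>n. b (Suc i) * x ^ Suc i * (euler_coeff b (n - i) * x ^ (n - i)))" .
qed simp

text \<open>The recurrence is the differential equation x F' = F B read coefficientwise. In this
  form the product rule shows how solutions multiply.\<close>

lemma fps_euler_coeff_rec:
  fixes F B :: "real fps"
  assumes "fps_nth B 0 = 0"
  shows "fps_X * fps_deriv F = F * B \<longleftrightarrow>
    (\<forall>n. real (Suc n) * fps_nth F (Suc n) = (\<Sum>i\<le>n. fps_nth B (Suc i) * fps_nth F (n - i)))"
proof -
  have *: "fps_nth (F * B) (Suc n) = (\<Sum>i\<le>n. fps_nth B (Suc i) * fps_nth F (n - i))" for n
    using assms by (subst mult.commute, unfold fps_mult_nth atMost_atLeast0[symmetric])
      (simp add: sum.atMost_Suc_shift del: sum.atMost_Suc)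
  have "(\<forall>n. P n) \<longleftrightarrow> P 0 \<and> (\<forall>n. P (Suc n))" for P :: "nat \<Rightarrow> bool"
    by (metis nat.exhaust)
  from this[of "\<lambda>n. fps_nth (fps_X * fps_deriv F) n = fps_nth (F * B) n"]
  show ?thesis using assms by (simp add: fps_eq_iff *)
qed

text \<open>The exponential of a sum is the product of the exponentials: the product rule adds the
  logarithmic derivatives \<open>B\<close> and \<open>B'\<close>, and
  \<open>euler_coeff_unique\<close> identifies the product. It splits off the minorant in
  \<open>euler_coeff_ratio_of_minorant\<close>.\<close>

lemma euler_coeff_add:
  "euler_coeff (\<lambda>k. b k + b' k) n = (\<Sum>i\<le>n. euler_coeff b i * euler_coeff b' (n - i))"
proof -
  \<comment> \<open>The constant terms of \<open>B\<close> and \<open>B'\<close> are set to 0, as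
    \<open>fps_euler_coeff_rec\<close> demands.\<close>
  define F G B B' where "F = Abs_fps (euler_coeff b)" "G = Abs_fps (euler_coeff b')"
    "B = Abs_fps (\<lambda>k. if k = 0 then 0 else b k)" "B' = Abs_fps (\<lambda>k. if k = 0 then 0 else b' k)"
  note defs = this
  have F: "fps_X * fps_deriv F = F * B"
    by (subst fps_euler_coeff_rec) (simp_all add: defs euler_coeff_rec[symmetric] del: of_nat_Suc)
  have G: "fps_X * fps_deriv G = G * B'"
    by (subst fps_euler_coeff_rec) (simp_all add: defs euler_coeff_rec[symmetric] del: of_nat_Suc)
  have "fps_X * fps_deriv (F * G) = F * (fps_X * fps_deriv G) + (fps_X * fps_deriv F) * G"
    by (simp add: algebra_simps)
  also have "\<dots> = (F * G) * (B + B')" unfolding F G by (simp add: algebra_simps)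
  finally have "fps_X * fps_deriv (F * G) = (F * G) * (B + B')" .
  then have "real (Suc n) * fps_nth (F * G) (Suc n) = (\<Sum>i\<le>n. fps_nth (B + B') (Suc i) * fps_nth (F * G) (n - i))" for n
    using fps_euler_coeff_rec[of "B + B'" "F * G"] by (simp add: defs)
  then have "fps_nth (F * G) n = euler_coeff (\<lambda>k. b k + b' k) n"
    by (intro euler_coeff_unique) (simp_all add: defs)
  then show ?thesis by (simp add: fps_mult_nth defs atMost_atLeast0)
qed

section \<open>Ratio limits from the recurrence\<close>

lemma convolution_Suc:
  fixes u h :: "nat \<Rightarrow> real"
  shows "(\<Sum>i\<le>Suc n. u i * h (Suc n - i)) = u 0 * h (Suc n) + (\<Sum>i\<le>n. u (Suc i) * h (n - i))"
  by (simp add: sum.atMost_Suc_shift del: sum.atMost_Suc)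

text \<open>Between the recurrences at n + 1 and n + 2 each summand gains the factor b (i + 2) / b
  (i + 1), and one new summand b 1 e (n + 1) appears. Hence e (n + 2) / e (n + 1) is (n + 1) / (n +
  2) times 1 + b 1 / (n + 1) + a weighted mean of the numbers b (i + 2) / b (i + 1) - 1, to which
  \<open>toeplitz_null\<close> applies.\<close>

lemma euler_coeff_ratio_tendsto_1:
  assumes pos: "\<And>k. k \<ge> 1 \<Longrightarrow> b k > 0"
    and lim: "(\<lambda>k. b (Suc k) / b k) \<longlonglongrightarrow> 1"
  shows "(\<lambda>n. euler_coeff b (Suc n) / euler_coeff b n) \<longlonglongrightarrow> 1"
proof -
  define e where "e = euler_coeff b"
  have e_pos: "e n > 0" for n unfolding e_def by (rule euler_coeff_pos[OF pos])
  have rec: "real (Suc n) * e (Suc n) = (\<Sum>i\<le>n. b (Suc i) * e (n - i))" for n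
    unfolding e_def by (rule euler_coeff_rec)
  have "(\<lambda>k. b k / b (Suc k)) \<longlonglongrightarrow> 1"
    using tendsto_inverse[OF lim] by simp
  then have "Bseq (\<lambda>k. b k / b (Suc k))"
    by (rule convergent_imp_Bseq[OF convergentI])
  then obtain C where C: "C > 0" "\<And>k. \<bar>b k / b (Suc k)\<bar> \<le> C" by (auto elim: BseqE)
  have bC: "b k \<le> C * b (Suc k)" if "k \<ge> 1" for k
    using C(2)[of k] pos[of "Suc k"] by (simp add: abs_le_iff pos_divide_le_eq)
  \<comment> \<open>Shifting the recurrence by one and using \<open>b k \<le> C * b (Suc k)\<close> termwise bounds \<open>e n / e (Suc n)\<close>.\<close>
  have step: "real (Suc n) * e (Suc n) \<le> C * (real (Suc (Suc n)) * e (Suc (Suc n)))" for n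
  proof -
    have "real (Suc n) * e (Suc n) \<le> (\<Sum>i\<le>n. C * (b (Suc (Suc i)) * e (n - i)))"
      unfolding rec using e_pos bC
      by (intro sum_mono) (simp add: mult.assoc[symmetric] mult_right_mono less_imp_le)
    also have "\<dots> = C * (\<Sum>i\<le>n. b (Suc (Suc i)) * e (n - i))" by (simp add: sum_distrib_left)
    also have "\<dots> \<le> C * (\<Sum>i\<le>Suc n. b (Suc i) * e (Suc n - i))"
      using C e_pos[of "Suc n"] pos[of 1]
      unfolding convolution_Suc[of "\<lambda>i. b (Suc i)"]
      by (intro mult_left_mono) (auto intro!: mult_nonneg_nonneg less_imp_le)
    also have "\<dots> = C * (real (Suc (Suc n)) * e (Suc (Suc n)))" by (simp only: rec)
    finally show ?thesis .
  qed
  \<comment> \<open>Here n + 2 \<le> 2 (n + 1) costs the factor 2.\<close>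
  have eD: "e (Suc n) \<le> 2 * C * e (Suc (Suc n))" for n
  proof -
    have "real (Suc n) * e (Suc n) \<le> C * (real (2 * Suc n) * e (Suc (Suc n)))"
      using C(1) e_pos[of "Suc (Suc n)"]
      by (intro order_trans[OF step] mult_left_mono mult_right_mono) auto
    then have "real (Suc n) * e (Suc n) \<le> real (Suc n) * (2 * C * e (Suc (Suc n)))"
      by (simp add: algebra_simps)
    then show ?thesis by (simp only: mult_le_cancel_left_pos of_nat_0_less_iff zero_less_Suc)
  qed
  \<comment> \<open>\<open>eD\<close> starts at index 1; the second entry of the maximum covers e 0
    \<le> D e 1.\<close>
  define D where "D = max (2 * C) (e 0 / e 1)"
  have D: "e n \<le> D * e (Suc n)" for n
  proof (cases n)
    case 0
    have "e 0 = e 0 / e 1 * e 1" using e_pos[of 1] by simp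
    also have "\<dots> \<le> D * e 1" using e_pos[of 1] by (intro mult_right_mono) (auto simp: D_def)
    finally show ?thesis using 0 by simp
  next
    case (Suc k)
    show ?thesis unfolding Suc
      using e_pos[of "Suc (Suc k)"] by (intro order_trans[OF eD] mult_right_mono) (auto simp: D_def)
  qed
  have D0: "D > 0" using C by (auto simp: D_def)
  have Dpow: "e n \<le> D ^ k * e (n + k)" for n k
  proof (induction k)
    case (Suc k)
    have "e n \<le> D ^ k * e (n + k)" by fact
    also have "\<dots> \<le> D ^ k * (D * e (Suc (n + k)))" using D0 D by (intro mult_left_mono) auto
    finally show ?case by (simp add: mult_ac)
  qed simp
  \<comment> \<open>The weights are the shares of the summands in the recurrence for e (n + 1), so
    each row sums to 1. A column vanishes because e (n - i) / e (n + 1) is at most D^(i + 1), while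
    the denominator carries the factor n + 1.\<close>
  define x where "x = (\<lambda>i. b (Suc (Suc i)) / b (Suc i) - 1)"
  define w where "w = (\<lambda>n i. b (Suc i) * e (n - i) / (real (Suc n) * e (Suc n)))"
  have "(\<lambda>n. \<Sum>i\<le>n. w n i * x i) \<longlonglongrightarrow> 0"
  proof (rule toeplitz_null)
    show "0 \<le> w n i" for n i
      using pos[of "Suc i"] e_pos by (auto simp: w_def less_imp_le)
    show "(\<Sum>i\<le>n. w n i) \<le> 1" for n
      using e_pos[of "Suc n"] unfolding w_def sum_divide_distrib[symmetric] rec[symmetric] by simp
    show "x \<longlonglongrightarrow> 0"
      using LIMSEQ_Suc[OF lim] unfolding x_def by (auto intro: tendsto_eq_intros)
    show "(\<lambda>n. w n i) \<longlonglongrightarrow> 0" for i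
    proof (rule tendsto_sandwich[where f = "\<lambda>_. 0"])
      show "(\<lambda>n. b (Suc i) * D ^ Suc i / real (Suc n)) \<longlonglongrightarrow> 0"
        by real_asymp
      show "\<forall>\<^sub>F n in sequentially. w n i \<le> b (Suc i) * D ^ Suc i / real (Suc n)"
        using eventually_ge_at_top[of i]
      proof eventually_elim
        case (elim n)
        have "e (n - i) \<le> D ^ Suc i * e (Suc n)" using Dpow[of "n - i" "Suc i"] elim by simp
        then have "b (Suc i) * e (n - i) / (real (Suc n) * e (Suc n)) \<le>
            b (Suc i) * (D ^ Suc i * e (Suc n)) / (real (Suc n) * e (Suc n))"
          using pos[of "Suc i"] e_pos[of "Suc n"]
          by (intro divide_right_mono mult_left_mono) (auto simp: less_imp_le)
        then show ?case using e_pos[of "Suc n"] by (simp add: w_def less_le)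
      qed
      show "\<forall>\<^sub>F n in sequentially. 0 \<le> w n i"
        using pos[of "Suc i"] e_pos by (auto simp: w_def less_imp_le)
    qed auto
  qed
  moreover have "(\<lambda>n. b 1 / real (Suc n)) \<longlonglongrightarrow> 0" by real_asymp
  moreover have "(\<lambda>n. real (Suc n) / real (Suc (Suc n))) \<longlonglongrightarrow> 1" by real_asymp
  ultimately have "(\<lambda>n. real (Suc n) / real (Suc (Suc n)) *
      (1 + b 1 / real (Suc n) + (\<Sum>i\<le>n. w n i * x i))) \<longlonglongrightarrow> 1 * (1 + 0 + 0)"
    by (intro tendsto_intros)
  moreover have "real (Suc n) / real (Suc (Suc n)) *
      (1 + b 1 / real (Suc n) + (\<Sum>i\<le>n. w n i * x i)) = e (Suc (Suc n)) / e (Suc n)" for n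
  proof -
    define T where "T = real (Suc n) * e (Suc n)"
    have T: "T > 0" using e_pos[of "Suc n"] by (simp add: T_def)
    have "(\<Sum>i\<le>n. w n i * x i) = (\<Sum>i\<le>n. (b (Suc (Suc i)) * e (n - i) - b (Suc i) * e (n - i)) / T)"
    proof (intro sum.cong refl)
      fix i show "w n i * x i = (b (Suc (Suc i)) * e (n - i) - b (Suc i) * e (n - i)) / T"
        using pos[of "Suc i"] T unfolding w_def x_def T_def[symmetric] by (simp add: field_simps)
    qed
    also have "\<dots> = ((\<Sum>i\<le>n. b (Suc (Suc i)) * e (n - i)) - T) / T"
      by (simp only: sum_divide_distrib[symmetric] sum_subtractf T_def rec)
    also have "(\<Sum>i\<le>n. b (Suc (Suc i)) * e (n - i)) = real (Suc (Suc n)) * e (Suc (Suc n)) - b 1 * e (Suc n)"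
      unfolding rec convolution_Suc[of "\<lambda>i. b (Suc i)"] by simp
    finally have *: "(\<Sum>i\<le>n. w n i * x i) = (real (Suc (Suc n)) * e (Suc (Suc n)) - b 1 * e (Suc n) - T) / T" .
    have "b 1 / real (Suc n) = b 1 * e (Suc n) / T" using e_pos[of "Suc n"] by (simp add: T_def)
    then have "1 + b 1 / real (Suc n) + (\<Sum>i\<le>n. w n i * x i) = real (Suc (Suc n)) * e (Suc (Suc n)) / T"
      unfolding * using T by (simp add: add_divide_distrib diff_divide_distrib del: of_nat_Suc)
    then show ?thesis by (simp add: T_def del: of_nat_Suc)
  qed
  ultimately have "(\<lambda>n. e (Suc (Suc n)) / e (Suc n)) \<longlonglongrightarrow> 1" by simp
  then show ?thesis unfolding e_def by (rule LIMSEQ_imp_Suc)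
qed

text \<open>By \<open>euler_coeff_add\<close>, c is the convolution of the regular sequence u with a
  nonnegative h. The quotient c (n + 1) / c n equals 1 plus the boundary term h (n + 1) / c n plus a
  weighted mean of u (i + 1) / u i - 1. The boundary term and the columns of the weights vanish once
  h is small compared with c, which is where the smallness assumption on b enters.\<close>

lemma euler_coeff_ratio_of_minorant:
  assumes b'_pos: "\<And>k. k \<ge> 1 \<Longrightarrow> b' k > 0" and b'_le: "\<And>k. k \<ge> 1 \<Longrightarrow> b' k \<le> b k"
    and lim: "(\<lambda>n. euler_coeff b' (Suc n) / euler_coeff b' n) \<longlonglongrightarrow> 1"
    and small: "(\<lambda>n. b (Suc n) / (real (Suc n) * euler_coeff b' n)) \<longlonglongrightarrow> 0"
  shows "(\<lambda>n. euler_coeff b (Suc n) / euler_coeff b n) \<longlonglongrightarrow> 1"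
proof -
  define u h c where "u = euler_coeff b'" "h = euler_coeff (\<lambda>k. b k - b' k)" "c = euler_coeff b"
  note defs = this
  have u_pos: "u n > 0" for n unfolding defs by (rule euler_coeff_pos[OF b'_pos])
  have b_pos: "b k > 0" if "k \<ge> 1" for k using b'_pos[OF that] b'_le[OF that] by linarith
  have c_pos: "c n > 0" for n unfolding defs by (rule euler_coeff_pos[OF b_pos])
  have h_nonneg: "h n \<ge> 0" for n unfolding defs using b'_le by (intro euler_coeff_nonneg) auto
  have c_conv: "c n = (\<Sum>i\<le>n. u i * h (n - i))" for n
    using euler_coeff_add[of b' "\<lambda>k. b k - b' k" n] by (simp add: defs)
  have "(\<lambda>k. u k / u (Suc k)) \<longlonglongrightarrow> 1"
    using tendsto_inverse[OF lim] by (simp add: defs)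
  then have "Bseq (\<lambda>k. u k / u (Suc k))"
    by (rule convergent_imp_Bseq[OF convergentI])
  then obtain C where C: "C > 0" "\<And>k. \<bar>u k / u (Suc k)\<bar> \<le> C" by (auto elim: BseqE)
  have uC: "u k \<le> C * u (Suc k)" for k
    using C(2)[of k] u_pos[of "Suc k"] by (simp add: abs_le_iff pos_divide_le_eq)
  \<comment> \<open>Dropping the summand with u 0 in the convolution for c (n + 1) and comparing the
    others termwise bounds c n / c (n + 1).\<close>
  have cC: "c n \<le> C * c (Suc n)" for n
  proof -
    have "c n \<le> (\<Sum>i\<le>n. C * (u (Suc i) * h (n - i)))"
      unfolding c_conv using uC h_nonneg
      by (intro sum_mono) (simp add: mult.assoc[symmetric] mult_right_mono)
    also have "\<dots> = C * (\<Sum>i\<le>n. u (Suc i) * h (n - i))" by (simp add: sum_distrib_left)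
    also have "\<dots> \<le> C * c (Suc n)"
      unfolding c_conv[of "Suc n"] convolution_Suc
      using C h_nonneg[of "Suc n"] u_pos[of 0] by (intro mult_left_mono) auto
    finally show ?thesis .
  qed
  have cCpow: "c n \<le> C ^ k * c (n + k)" for n k
  proof (induction k)
    case (Suc k)
    have "c n \<le> C ^ k * c (n + k)" by fact
    also have "\<dots> \<le> C ^ k * (C * c (Suc (n + k)))" using C cC by (intro mult_left_mono) auto
    finally show ?case by (simp add: mult_ac)
  qed simp
  have term_le: "u i * h (n - i) \<le> c n" if "i \<le> n" for i n
    unfolding c_conv using that u_pos h_nonneg
    by (intro member_le_sum) (auto simp: less_imp_le)

  have h_small: "(\<lambda>n. h (Suc n) / c n) \<longlonglongrightarrow> 0"
  proof (rule tendsto_sandwich[where f = "\<lambda>_. 0"])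
    \<comment> \<open>The recurrence for h, with b - b' enlarged to b, bounds h (n + 1) / c n by an
      average of b (i + 1) / ((i + 1) u i), which is null by assumption. The remaining factors form
      the weights; they are dominated by the shares u i h (n - i) / c n of c n.\<close>
    define x where "x = (\<lambda>i. b (Suc i) / (real (Suc i) * u i))"
    define w where "w = (\<lambda>n i. (real (Suc i) / real (Suc n)) * (u i * h (n - i) / c n))"
    show "(\<lambda>n. \<Sum>i\<le>n. w n i * x i) \<longlonglongrightarrow> 0"
    proof (rule toeplitz_null)
      show nonneg: "0 \<le> w n i" for n i
        unfolding w_def using u_pos[of i] h_nonneg[of "n - i"] c_pos[of n] by simp
      have le: "w n i \<le> u i * h (n - i) / c n" if "i \<le> n" for n i
        unfolding w_def using that u_pos[of i] h_nonneg[of "n - i"] c_pos[of n]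
        by (intro mult_left_le_one_le) auto
      show "(\<Sum>i\<le>n. w n i) \<le> 1" for n
      proof -
        have "(\<Sum>i\<le>n. w n i) \<le> (\<Sum>i\<le>n. u i * h (n - i) / c n)" using le by (intro sum_mono) auto
        also have "\<dots> = 1" using c_pos[of n] by (simp add: sum_divide_distrib[symmetric] c_conv[symmetric])
        finally show ?thesis .
      qed
      show "(\<lambda>n. w n i) \<longlonglongrightarrow> 0" for i
      proof (rule tendsto_sandwich[where f = "\<lambda>_. 0"])
        show "(\<lambda>n. real (Suc i) / real (Suc n)) \<longlonglongrightarrow> 0" by real_asymp
        show "\<forall>\<^sub>F n in sequentially. w n i \<le> real (Suc i) / real (Suc n)"
          using eventually_ge_at_top[of i]
        proof eventually_elim
          case (elim n)
          have "u i * h (n - i) / c n \<le> 1" using term_le[OF elim] c_pos[of n] by simp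
          then show ?case unfolding w_def using u_pos[of i] h_nonneg[of "n - i"] c_pos[of n]
            by (intro mult_right_le_one_le) auto
        qed
      qed (use nonneg in auto)
      show "x \<longlonglongrightarrow> 0" using small by (simp add: x_def defs)
    qed
    have "h (Suc n) / c n \<le> (\<Sum>i\<le>n. w n i * x i)" for n
    proof -
      have "real (Suc n) * h (Suc n) = (\<Sum>i\<le>n. (b (Suc i) - b' (Suc i)) * h (n - i))"
        unfolding defs by (rule euler_coeff_rec)
      also have "\<dots> \<le> (\<Sum>i\<le>n. b (Suc i) * h (n - i))"
        using b'_pos h_nonneg by (intro sum_mono mult_right_mono) (auto intro: less_imp_le)
      finally have "real (Suc n) * h (Suc n) / (real (Suc n) * c n) \<le>
          (\<Sum>i\<le>n. b (Suc i) * h (n - i)) / (real (Suc n) * c n)"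
        using c_pos[of n] by (intro divide_right_mono) auto
      also have "\<dots> = (\<Sum>i\<le>n. w n i * x i)"
        unfolding sum_divide_distrib
      proof (intro sum.cong refl)
        fix i show "b (Suc i) * h (n - i) / (real (Suc n) * c n) = w n i * x i"
          unfolding w_def x_def using u_pos[of i] by (simp add: field_simps del: of_nat_Suc)
      qed
      finally show ?thesis by simp
    qed
    then show "\<forall>\<^sub>F n in sequentially. h (Suc n) / c n \<le> (\<Sum>i\<le>n. w n i * x i)" by simp
    show "\<forall>\<^sub>F n in sequentially. 0 \<le> h (Suc n) / c n"
      using h_nonneg c_pos by (intro always_eventually allI divide_nonneg_pos) auto
  qed auto

  \<comment> \<open>A fixed index shift is harmless, since c n \<le> C^k c (n + k) by
    \<open>cCpow\<close>.\<close>
  have h_small': "(\<lambda>n. h (n - i) / c n) \<longlonglongrightarrow> 0" for i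
  proof -
    have "(\<lambda>n. h (Suc n) / c (n + Suc i)) \<longlonglongrightarrow> 0"
    proof (rule tendsto_sandwich[where f = "\<lambda>_. 0"])
      show "(\<lambda>n. C ^ Suc i * (h (Suc n) / c n)) \<longlonglongrightarrow> 0"
        using tendsto_mult_left[OF h_small, of "C ^ Suc i"] by simp
      have "h (Suc n) / c (n + Suc i) \<le> C ^ Suc i * (h (Suc n) / c n)" for n
      proof -
        have "c n / c (n + Suc i) \<le> C ^ Suc i"
          using cCpow[of n "Suc i"] c_pos[of "n + Suc i"] by (simp add: pos_divide_le_eq)
        then have "(h (Suc n) / c n) * (c n / c (n + Suc i)) \<le> (h (Suc n) / c n) * C ^ Suc i"
          using h_nonneg c_pos by (intro mult_left_mono) (auto intro!: divide_nonneg_pos)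
        then show ?thesis using c_pos[of n] by (simp add: mult.commute)
      qed
      then show "\<forall>\<^sub>F n in sequentially. h (Suc n) / c (n + Suc i) \<le> C ^ Suc i * (h (Suc n) / c n)"
        by simp
      show "\<forall>\<^sub>F n in sequentially. 0 \<le> h (Suc n) / c (n + Suc i)"
        using h_nonneg c_pos by (intro always_eventually allI divide_nonneg_pos) auto
    qed auto
    then have "(\<lambda>n. h ((n + Suc i) - i) / c (n + Suc i)) \<longlonglongrightarrow> 0" by (simp add: Suc_diff_le)
    then show ?thesis by (rule LIMSEQ_offset)
  qed

  \<comment> \<open>Now the weights are the shares themselves; their columns vanish by
    \<open>h_small'\<close>.\<close>
  define x where "x = (\<lambda>i. u (Suc i) / u i - 1)"
  define w where "w = (\<lambda>n i. u i * h (n - i) / c n)"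
  have "(\<lambda>n. \<Sum>i\<le>n. w n i * x i) \<longlonglongrightarrow> 0"
  proof (rule toeplitz_null)
    show "0 \<le> w n i" for n i
      unfolding w_def using u_pos[of i] h_nonneg[of "n - i"] c_pos[of n] by simp
    show "(\<Sum>i\<le>n. w n i) \<le> 1" for n
      using c_pos[of n] by (simp add: w_def sum_divide_distrib[symmetric] c_conv[symmetric])
    show "(\<lambda>n. w n i) \<longlonglongrightarrow> 0" for i
      using tendsto_mult_left[OF h_small', of "u i" i] by (simp add: w_def)
    show "x \<longlonglongrightarrow> 0"
      using tendsto_diff[OF lim tendsto_const[of 1]] by (simp add: x_def defs)
  qed
  then have "(\<lambda>n. 1 + h (Suc n) / c n + (\<Sum>i\<le>n. w n i * x i)) \<longlonglongrightarrow> 1 + 0 + 0"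
    by (intro tendsto_intros h_small)
  moreover have "1 + h (Suc n) / c n + (\<Sum>i\<le>n. w n i * x i) = c (Suc n) / c n" for n
  proof -
    have "(\<Sum>i\<le>n. w n i * x i) = (\<Sum>i\<le>n. (u (Suc i) * h (n - i) - u i * h (n - i)) / c n)"
    proof (intro sum.cong refl)
      fix i show "w n i * x i = (u (Suc i) * h (n - i) - u i * h (n - i)) / c n"
        unfolding w_def x_def using u_pos[of i] c_pos[of n] by (simp add: field_simps)
    qed
    also have "\<dots> = ((\<Sum>i\<le>n. u (Suc i) * h (n - i)) - c n) / c n"
      by (simp only: sum_divide_distrib[symmetric] sum_subtractf c_conv)
    also have "(\<Sum>i\<le>n. u (Suc i) * h (n - i)) = c (Suc n) - h (Suc n)"
      unfolding c_conv[of "Suc n"] convolution_Suc by (simp add: defs)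
    finally show ?thesis using c_pos[of n] by (simp add: diff_divide_distrib)
  qed
  ultimately show ?thesis by (simp add: defs)
qed

section \<open>Growth of the generated coefficients\<close>

text \<open>Discrete form of the comparison of a power sum with an integral. The induction adds up
  the Bernoulli-type estimate (x + 1)^(t + 1) - x^(t + 1) \<le> (t + 1) (x + 1)^t.\<close>

lemma sum_power_ge: "real (Suc m) ^ Suc t \<le> real (Suc t) * (\<Sum>j\<le>m. real (Suc j) ^ t)"
proof -
  have bern: "(x + 1) ^ Suc t \<le> x ^ Suc t + real (Suc t) * (x + 1) ^ t" if "x \<ge> 0" for x :: real and t
  proof (induction t)
    case (Suc t)
    have "(x + 1) ^ Suc (Suc t) = x * (x + 1) ^ Suc t + (x + 1) ^ Suc t" by (simp add: algebra_simps)
    also have "x * (x + 1) ^ Suc t \<le> x * (x ^ Suc t + real (Suc t) * (x + 1) ^ t)"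
      using Suc that by (intro mult_left_mono) auto
    also have "\<dots> \<le> x ^ Suc (Suc t) + real (Suc t) * (x + 1) ^ Suc t"
      using that by (simp add: algebra_simps mult_left_mono)
    finally show ?case by (simp add: algebra_simps)
  qed auto
  show ?thesis
  proof (induction m)
    case (Suc m)
    have "real (Suc (Suc m)) ^ Suc t \<le> real (Suc m) ^ Suc t + real (Suc t) * real (Suc (Suc m)) ^ t"
      using bern[of "real (Suc m)" t] by (simp add: add.commute)
    also have "\<dots> \<le> real (Suc t) * (\<Sum>j\<le>Suc m. real (Suc j) ^ t)"
      using Suc by (simp add: distrib_left del: of_nat_Suc)
    finally show ?case .
  qed simp
qed

text \<open>A constant b = M generates (1 - x)^(-M), with coefficients of order n^(M - 1). As b
  eventually exceeds every M, the coefficients should outgrow every power; the proof is a direct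
  induction on the recurrence.\<close>

lemma euler_coeff_superpolynomial:
  assumes pos: "\<And>k. k \<ge> 1 \<Longrightarrow> b k > 0" and top: "filterlim b at_top sequentially"
  shows "\<exists>C>0. \<forall>n. C * real (Suc n) ^ t \<le> euler_coeff b n"
proof -
  define e where "e = euler_coeff b"
  have e_pos: "e n > 0" for n unfolding e_def by (rule euler_coeff_pos[OF pos])
  \<comment> \<open>The factor t + 1 pays for \<open>sum_power_ge\<close>; the factor 2 pays for
    replacing n + 1 by n - K in the power t + 1, which the choice of \<open>N\<close> below
    permits.\<close>
  define M where "M = 2 * real (Suc t)"
  obtain K where K: "\<And>k. k \<ge> K \<Longrightarrow> b k \<ge> M"
    using top by (auto simp: filterlim_at_top eventually_sequentially)
  have "(\<lambda>n. (real n / real (n + K + 1)) ^ Suc t) \<longlonglongrightarrow> 1 ^ Suc t"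
    by (intro tendsto_power) real_asymp
  then have "\<forall>\<^sub>F n in sequentially. (real n / real (n + K + 1)) ^ Suc t > 1 / 2"
    by (intro order_tendstoD(1)) auto
  then obtain N where N: "\<And>n. n \<ge> N \<Longrightarrow> (real n / real (n + K + 1)) ^ Suc t > 1 / 2"
    by (auto simp: eventually_sequentially)
  \<comment> \<open>The minimum over the initial range settles the base cases of the
    induction.\<close>
  define C where "C = Min ((\<lambda>n. e n / real (Suc n) ^ t) ` {..N + K})"
  have C_pos: "C > 0" unfolding C_def using e_pos by (subst Min_gr_iff) auto
  have "C * real (Suc n) ^ t \<le> e n" for n
  proof (induction n rule: less_induct)
    case (less n)
    show ?case
    proof (cases "n \<le> N + K")
      case True
      then have "C \<le> e n / real (Suc n) ^ t" unfolding C_def by (intro Min_le) auto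
      then show ?thesis by (simp add: pos_le_divide_eq del: of_nat_Suc)
    next
      case False
      \<comment> \<open>For j \<le> q the factor of e j in the recurrence has index n - j > K, so it
        is at least \<open>M\<close>; the remaining summands are dropped.\<close>
      define q where "q = n - Suc K"
      have n: "n = Suc (q + K)" and q: "Suc q \<ge> N" using False by (auto simp: q_def)
      have "M * (C * (\<Sum>j\<le>q. real (Suc j) ^ t)) = (\<Sum>j\<le>q. M * (C * real (Suc j) ^ t))"
        by (simp add: sum_distrib_left)
      also have "\<dots> \<le> (\<Sum>j\<le>q. b (Suc (q + K - j)) * e j)"
        using K less n C_pos by (intro sum_mono mult_mono) (auto simp: M_def intro!: order_trans[OF _ K])
      also have "\<dots> \<le> (\<Sum>j\<le>q + K. b (Suc (q + K - j)) * e j)"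
        using pos e_pos by (intro sum_mono2) (auto intro!: mult_nonneg_nonneg less_imp_le)
      also have "\<dots> = (\<Sum>i\<le>q + K. b (Suc i) * e (q + K - i))"
        by (rule sum.reindex_bij_witness[of _ "\<lambda>i. q + K - i" "\<lambda>i. q + K - i"]) auto
      also have "\<dots> = real n * e n" unfolding n e_def by (rule euler_coeff_rec[symmetric])
      finally have 1: "M * (C * (\<Sum>j\<le>q. real (Suc j) ^ t)) \<le> real n * e n" .
      have "real (Suc n) ^ Suc t \<le> 2 * real (Suc q) ^ Suc t"
        using N[OF q] by (simp add: n power_divide field_simps del: power_Suc)
      then have "real n * real (Suc n) ^ t \<le> 2 * real (Suc q) ^ Suc t"
        by (rule order_trans[rotated]) (simp add: mult_right_mono)
      also have "\<dots> \<le> M * (\<Sum>j\<le>q. real (Suc j) ^ t)"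
        using mult_left_mono[OF sum_power_ge[of q t], of 2]
        by (simp add: M_def mult.assoc del: of_nat_Suc power_Suc)
      finally have "C * (real n * real (Suc n) ^ t) \<le> C * (M * (\<Sum>j\<le>q. real (Suc j) ^ t))"
        using C_pos by (intro mult_left_mono) auto
      also have "\<dots> \<le> real n * e n" using 1 by (simp add: mult_ac)
      finally have "real n * (C * real (Suc n) ^ t) \<le> real n * e n" by (simp only: mult_ac)
      then show ?thesis using n by (simp only: mult_le_cancel_left_pos of_nat_0_less_iff zero_less_Suc)
    qed
  qed
  then show ?thesis using C_pos unfolding e_def by blast
qed

text \<open>The generating function is (1 - x)^(-g), so the product is of order n^g. Elementary
  argument: e k \<ge> g / k makes the partial sums of e at least g times a harmonic number, and the
  recurrence says that (n + 1) e (n + 1) is g times a partial sum.\<close>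

lemma euler_coeff_const_times_index_at_top:
  assumes g: "g > 0"
  shows "filterlim (\<lambda>n. real n * euler_coeff (\<lambda>_. g) n) at_top sequentially"
proof -
  define e where "e = euler_coeff (\<lambda>_. g)"
  have "real (Suc n) * e (Suc n) \<ge> g * (g * harm n)" for n
  proof -
    have "g * harm n = (\<Sum>k=1..n. g / real k)"
      by (simp add: harm_def sum_distrib_left field_simps)
    also have "\<dots> \<le> (\<Sum>k=1..n. e k)"
    proof (intro sum_mono)
      fix k assume "k \<in> {1..n}"
      then obtain j where "k = Suc j" by (cases k) auto
      then show "g / real k \<le> e k" unfolding e_def using g euler_coeff_ge[of "\<lambda>_. g" j] by simp
    qed
    also have "\<dots> \<le> (\<Sum>k\<le>n. e k)"
      unfolding e_def using g by (intro sum_mono2 euler_coeff_nonneg) auto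
    also have "\<dots> = (\<Sum>i\<le>n. e (n - i))"
      by (rule sum.reindex_bij_witness[of _ "\<lambda>i. n - i" "\<lambda>i. n - i"]) auto
    finally have "g * (g * harm n) \<le> g * (\<Sum>i\<le>n. e (n - i))" using g by (intro mult_left_mono) auto
    also have "\<dots> = real (Suc n) * e (Suc n)"
      unfolding e_def euler_coeff_rec by (simp add: sum_distrib_left)
    finally show ?thesis .
  qed
  moreover have "filterlim (\<lambda>n. g * (g * harm n)) at_top sequentially"
    using g by (intro filterlim_tendsto_pos_mult_at_top[OF tendsto_const] harm_at_top) auto
  ultimately have "filterlim (\<lambda>n. real (Suc n) * e (Suc n)) at_top sequentially"
    by (intro filterlim_at_top_mono[where g = "\<lambda>n. real (Suc n) * e (Suc n)"]) auto
  then show ?thesis unfolding e_def by (subst (asm) filterlim_sequentially_Suc)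
qed

section \<open>Ratio limits of convolutions\<close>

text \<open>The majorant for Tannery's theorem. From some N on each quotient is below \<sigma>; the
  point is a bound uniform in k, including those k for which n - k falls below N.\<close>

lemma ratio_geometric_bound:
  fixes c :: "nat \<Rightarrow> real"
  assumes pos: "\<forall>\<^sub>F n in sequentially. c n > 0"
    and lim: "(\<lambda>n. c n / c (Suc n)) \<longlonglongrightarrow> \<rho>" and \<sigma>: "\<rho> < \<sigma>" "0 < \<sigma>" "\<sigma> \<le> 1"
  obtains C N where "C > 0" "\<And>n. n \<ge> N \<Longrightarrow> c n > 0"
    "\<And>n k. n \<ge> N \<Longrightarrow> k \<le> n \<Longrightarrow> \<bar>c (n - k) / c n\<bar> \<le> C * \<sigma> ^ k"
proof -
  have "\<forall>\<^sub>F n in sequentially. c n > 0 \<and> c n / c (Suc n) < \<sigma>"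
    using order_tendstoD(2)[OF lim \<sigma>(1)] pos by eventually_elim auto
  then obtain N where N: "\<And>n. n \<ge> N \<Longrightarrow> c n > 0 \<and> c n / c (Suc n) < \<sigma>"
    by (auto simp: eventually_sequentially)
  have step: "c n \<le> \<sigma> * c (Suc n)" if "n \<ge> N" for n
    using N[OF that] N[of "Suc n"] that by (simp add: pos_divide_less_eq)
  have pow: "c n \<le> \<sigma> ^ k * c (n + k)" if "n \<ge> N" for n k
  proof (induction k)
    case (Suc k)
    have "c n \<le> \<sigma> ^ k * c (n + k)" by fact
    also have "\<dots> \<le> \<sigma> ^ k * (\<sigma> * c (Suc (n + k)))"
      using \<sigma> step[of "n + k"] that by (intro mult_left_mono) auto
    finally show ?case by (simp add: mult_ac)
  qed simp
  define M where "M = Max ((\<lambda>n. \<bar>c n\<bar>) ` {..N})"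
  have M: "\<bar>c n\<bar> \<le> M" if "n \<le> N" for n unfolding M_def using that by (intro Max_ge) auto
  have M0: "M \<ge> 0" using M[of 0] by linarith
  \<comment> \<open>The entry 1 serves n - k \<ge> N. Otherwise the absolute value of c (n - k) is
    at most \<open>M\<close>, c N / c n is at most \<sigma>^(n - N), and \<sigma>^n \<le> \<sigma>^k
    leaves the second entry.\<close>
  define C where "C = max 1 (M / c N / \<sigma> ^ N)"
  have bound: "\<bar>c (n - k) / c n\<bar> \<le> C * \<sigma> ^ k" if "k \<le> n" "n \<ge> N" for n k
  proof (cases "n - k \<ge> N")
    case True
    have "c (n - k) \<le> \<sigma> ^ k * c n" using pow[OF True, of k] that by simp
    then have "\<bar>c (n - k) / c n\<bar> \<le> \<sigma> ^ k"
      using N[OF True] N[OF that(2)] by (simp add: pos_divide_le_eq)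
    also have "\<dots> \<le> C * \<sigma> ^ k" using \<sigma> by (simp add: C_def)
    finally show ?thesis .
  next
    case False
    have cn: "c N \<le> \<sigma> ^ (n - N) * c n" using pow[of N "n - N"] that by simp
    have "\<sigma> ^ (n - N) * \<sigma> ^ N = \<sigma> ^ n" using that by (simp flip: power_add)
    also have "\<dots> \<le> \<sigma> ^ k" using \<sigma> that by (intro power_decreasing) auto
    finally have sg: "\<sigma> ^ (n - N) \<le> \<sigma> ^ k / \<sigma> ^ N" using \<sigma> by (simp add: pos_le_divide_eq)
    have cpos: "c N > 0" "c n > 0" using N that by auto
    have "\<bar>c (n - k) / c n\<bar> \<le> M / c n" using M[of "n - k"] False cpos by (simp add: divide_right_mono)
    also have "\<dots> = M / c N * (c N / c n)" using cpos by simp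
    also have "\<dots> \<le> M / c N * (\<sigma> ^ k / \<sigma> ^ N)"
    proof (intro mult_left_mono)
      have "c N / c n \<le> \<sigma> ^ (n - N)" using cn cpos by (simp add: pos_divide_le_eq)
      then show "c N / c n \<le> \<sigma> ^ k / \<sigma> ^ N" using sg by linarith
    qed (use M0 cpos in auto)
    also have "\<dots> = (M / c N / \<sigma> ^ N) * \<sigma> ^ k" by simp
    also have "\<dots> \<le> C * \<sigma> ^ k" using \<sigma> by (intro mult_right_mono) (auto simp: C_def)
    finally show ?thesis .
  qed
  show thesis
  proof (rule that)
    show "C > 0" by (simp add: C_def)
  qed (use N bound in auto)
qed

text \<open>For fixed k the quotient c (n - k) / c n tends to \<rho>^k, and
  \<open>ratio_geometric_bound\<close> dominates all terms by a summable sequence, so Tannery's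
  theorem exchanges limit and sum.\<close>

lemma convolution_ratio_tendsto:
  fixes a c :: "nat \<Rightarrow> real"
  assumes pos: "\<forall>\<^sub>F n in sequentially. c n > 0"
    and lim: "(\<lambda>n. c n / c (Suc n)) \<longlonglongrightarrow> \<rho>" and \<sigma>: "\<rho> < \<sigma>" "0 < \<sigma>" "\<sigma> \<le> 1"
    and sm: "summable (\<lambda>k. \<bar>a k\<bar> * \<sigma> ^ k)"
  shows "(\<lambda>n. (\<Sum>k\<le>n. a k * c (n - k)) / c n) \<longlonglongrightarrow> (\<Sum>k. a k * \<rho> ^ k)"
proof -
  obtain C N where C: "C > 0" and N: "\<And>n. n \<ge> N \<Longrightarrow> c n > 0"
    and bound: "\<And>n k. n \<ge> N \<Longrightarrow> k \<le> n \<Longrightarrow> \<bar>c (n - k) / c n\<bar> \<le> C * \<sigma> ^ k"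
    using ratio_geometric_bound[OF pos lim \<sigma>] by metis
  have ratio: "(\<lambda>n. c (n - k) / c n) \<longlonglongrightarrow> \<rho> ^ k" for k
  proof -
    have "(\<lambda>n. c n / c (n + k)) \<longlonglongrightarrow> \<rho> ^ k"
    proof (induction k)
      case 0
      have "\<forall>\<^sub>F n in sequentially. c n / c (n + 0) = \<rho> ^ 0" using pos by eventually_elim auto
      then show ?case by (rule tendsto_eventually)
    next
      case (Suc k)
      have "(\<lambda>n. c n / c (n + k) * (c (n + k) / c (Suc (n + k)))) \<longlonglongrightarrow> \<rho> ^ k * \<rho>"
        by (intro tendsto_mult Suc)
           (use LIMSEQ_ignore_initial_segment[OF lim, of k] in simp)
      moreover have "\<forall>\<^sub>F n in sequentially. c n / c (n + k) * (c (n + k) / c (Suc (n + k))) = c n / c (n + Suc k)"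
        using eventually_ge_at_top[of N]
      proof eventually_elim
        case (elim n)
        then show ?case using N[of "n + k"] by simp
      qed
      ultimately have "(\<lambda>n. c n / c (n + Suc k)) \<longlonglongrightarrow> \<rho> ^ k * \<rho>"
        by (rule Lim_transform_eventually)
      then show ?case by (simp add: mult.commute)
    qed
    then have "(\<lambda>n. c (n + k - k) / c (n + k)) \<longlonglongrightarrow> \<rho> ^ k" by simp
    then show ?thesis by (rule LIMSEQ_offset)
  qed
  \<comment> \<open>Extension by 0 for k > n turns the finite sums into series over a fixed index
    set.\<close>
  define f where "f = (\<lambda>k n. if k \<le> n then a k * (c (n - k) / c n) else 0)"
  have "(\<lambda>n. suminf (\<lambda>k. f k n)) \<longlonglongrightarrow> (\<Sum>k. a k * \<rho> ^ k)"
  proof (rule tannerys_theorem[THEN conjunct2, THEN conjunct2])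
    fix k
    have "(\<lambda>n. a k * (c (n - k) / c n)) \<longlonglongrightarrow> a k * \<rho> ^ k" by (intro tendsto_intros ratio)
    moreover have "\<forall>\<^sub>F n in sequentially. a k * (c (n - k) / c n) = f k n"
      using eventually_ge_at_top[of k] by eventually_elim (auto simp: f_def)
    ultimately show "f k \<longlonglongrightarrow> a k * \<rho> ^ k" by (rule Lim_transform_eventually)
  next
    have "norm (f k n) \<le> C * (\<bar>a k\<bar> * \<sigma> ^ k)" if "n \<ge> N" for k n
    proof (cases "k \<le> n")
      case True
      have "\<bar>a k\<bar> * \<bar>c (n - k) / c n\<bar> \<le> \<bar>a k\<bar> * (C * \<sigma> ^ k)"
        using bound[OF that True] by (intro mult_left_mono) auto
      then show ?thesis using True by (simp add: f_def abs_mult mult_ac)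
    next
      case False
      then show ?thesis using \<sigma> C by (simp add: f_def)
    qed
    then show "\<forall>\<^sub>F (k, n) in sequentially \<times>\<^sub>F sequentially. norm (f k n) \<le> C * (\<bar>a k\<bar> * \<sigma> ^ k)"
      unfolding eventually_prod_filter
      by (intro exI[of _ "\<lambda>_. True"] exI[of _ "\<lambda>n. n \<ge> N"]) auto
    show "summable (\<lambda>k. C * (\<bar>a k\<bar> * \<sigma> ^ k))" by (intro summable_mult sm)
  qed auto
  moreover have "suminf (\<lambda>k. f k n) = (\<Sum>k\<le>n. a k * c (n - k)) / c n" for n
  proof -
    have "suminf (\<lambda>k. f k n) = (\<Sum>k\<le>n. f k n)"
      by (intro suminf_finite) (auto simp: f_def)
    then show ?thesis by (simp add: f_def sum_divide_distrib)
  qed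
  ultimately show ?thesis by simp
qed

section \<open>Generating functions of multisets\<close>

text \<open>The series (1 - x^j)^(-r) for any real r; replacing \<open>r\<close> by
  \<open>- r\<close> gives the inverse.\<close>

definition nb_fps :: "real \<Rightarrow> nat \<Rightarrow> real fps" where
  "nb_fps r j = fps_binomial (-r) oo (- (fps_X ^ j))"

lemma nth_nb_fps:
  assumes "j > 0"
  shows "fps_nth (nb_fps r j) n = (if j dvd n then (r + real (n div j) - 1) gchoose (n div j) else 0)"
proof -
  have "nb_fps r j = (fps_binomial (-r) oo (- fps_X)) oo fps_X ^ j"
    unfolding nb_fps_def using assms
    by (subst fps_compose_assoc[symmetric]) (auto simp: fps_compose_uminus)
  moreover have "fps_nth (fps_binomial (-r) oo (- fps_X)) k = (r + real k - 1) gchoose k" for k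
    by (simp add: fps_compose_uminus' gbinomial_minus)
  ultimately show ?thesis by (simp add: fps_nth_compose_X_power)
qed

lemma nb_fps_mult_uminus:
  assumes "j > 0"
  shows "nb_fps r j * nb_fps (-r) j = 1"
  using assms fps_binomial_add_mult[of "-r" r]
  by (simp add: nb_fps_def fps_compose_mult_distrib[symmetric])

text \<open>The logarithmic derivative x F' / F of (1 - x^j)^(-r) is r j x^j / (1 - x^j), whose
  geometric expansion is the second factor. Everything is multiplied by 1 - x^j, which is cancelled
  at the end.\<close>

lemma nb_fps_deriv:
  assumes j: "j > 0"
  shows "fps_X * fps_deriv (nb_fps r j) =
    nb_fps r j * Abs_fps (\<lambda>n. if 0 < n \<and> j dvd n then r * real j else 0)"
    (is "_ = _ * ?L")
proof -
  let ?P = "fps_binomial (-r)" and ?g = "- (fps_X ^ j) :: real fps"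
  have g0: "fps_nth ?g 0 = 0" using j by simp
  have unit: "fps_nth (1 + fps_X :: real fps) 0 \<noteq> 0" by simp
  have "(1 + fps_X) * fps_deriv ?P = fps_const (-r) * ?P"
    unfolding fps_binomial_deriv using unit by (simp add: fps_divide_unit inverse_mult_eq_1' mult.left_commute)
  then have "((1 + fps_X) * fps_deriv ?P) oo ?g = (fps_const (-r) * ?P) oo ?g" by simp
  then have 1: "(1 - fps_X ^ j) * (fps_deriv ?P oo ?g) = fps_const (-r) * nb_fps r j"
    unfolding nb_fps_def using g0
    by (simp add: fps_compose_mult_distrib fps_compose_add_distrib)
  have L: "(1 - fps_X ^ j) * ?L = fps_const (r * real j) * fps_X ^ j"
  proof (rule fps_ext)
    fix n
    show "fps_nth ((1 - fps_X ^ j) * ?L) n = fps_nth (fps_const (r * real j) * fps_X ^ j) n"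
    proof (cases n j rule: linorder_cases)
      case less
      then have "(0 < n \<and> j dvd n) = False" using nat_dvd_not_less by blast
      then have "fps_nth ?L n = 0" by (simp only: fps_nth_Abs_fps if_False)
      with less show ?thesis by (simp add: left_diff_distrib fps_X_power_mult_nth del: fps_nth_Abs_fps)
    next
      case equal
      then show ?thesis using j by (simp add: algebra_simps fps_X_power_mult_nth)
    next
      case greater
      then show ?thesis using j dvd_minus_self[of j n]
        by (simp add: algebra_simps fps_X_power_mult_nth)
    qed
  qed
  have "(1 - fps_X ^ j) * (fps_X * fps_deriv (nb_fps r j)) =
      ((1 - fps_X ^ j) * (fps_deriv ?P oo ?g)) * (fps_X * fps_deriv ?g)"
    unfolding nb_fps_def fps_compose_deriv[OF g0] by (simp add: mult_ac)
  also have "fps_X * fps_deriv ?g = - (fps_const (real j) * fps_X ^ j)"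
  proof (rule fps_ext)
    fix n show "fps_nth (fps_X * fps_deriv ?g) n = fps_nth (- (fps_const (real j) * fps_X ^ j)) n"
      by (cases n) (auto simp: fps_X_power_nth)
  qed
  also have "((1 - fps_X ^ j) * (fps_deriv ?P oo ?g)) * - (fps_const (real j) * fps_X ^ j) =
      nb_fps r j * (fps_const (r * real j) * fps_X ^ j)"
    unfolding 1 by (simp flip: fps_const_mult fps_const_neg add: mult_ac)
  also have "\<dots> = (1 - fps_X ^ j) * (nb_fps r j * ?L)"
    by (simp only: L[symmetric] mult.left_commute)
  finally have "(1 - fps_X ^ j) * (fps_X * fps_deriv (nb_fps r j)) = (1 - fps_X ^ j) * (nb_fps r j * ?L)" .
  moreover have "fps_nth (1 - fps_X ^ j :: real fps) 0 \<noteq> 0" using j by simp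
  then have "(1 - fps_X ^ j :: real fps) \<noteq> 0" by (metis fps_zero_nth)
  ultimately show ?thesis using mult_cancel_left by blast
qed

lemma nb_fps_nth_0: "j > 0 \<Longrightarrow> fps_nth (nb_fps r j) 0 = 1"
  by (simp add: nth_nb_fps)

text \<open>The infinite product over \<open>j > l\<close>, truncated since factors with \<open>j > n\<close> leave the \<open>n\<close>-th coefficient unchanged.\<close>

definition tail_fps :: "(nat \<Rightarrow> real) \<Rightarrow> nat \<Rightarrow> real fps" where
  "tail_fps m l = Abs_fps (\<lambda>n. fps_nth (\<Prod>j\<in>{l<..n}. nb_fps (m j) j) n)"

lemma fps_nth_mult_nb_fps_low:
  assumes "n < j" shows "fps_nth (nb_fps r j * F) n = fps_nth F n"
proof -
  have "fps_nth (nb_fps r j * F) n = (\<Sum>i=0..n. fps_nth (nb_fps r j) i * fps_nth F (n - i))"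
    by (rule fps_mult_nth)
  also have "\<dots> = (\<Sum>i\<in>{0}. fps_nth (nb_fps r j) i * fps_nth F (n - i))"
    using assms by (intro sum.mono_neutral_right) (auto simp: nth_nb_fps dest: dvd_imp_le)
  finally show ?thesis using assms by (simp add: nb_fps_nth_0)
qed

text \<open>Multiplying by a factor with j > n does not affect degree n, so the truncation point can
  be raised; one common point then serves all coefficients of a product.\<close>

lemma nth_tail_fps:
  assumes "n \<le> N"
  shows "fps_nth (tail_fps m l) n = fps_nth (\<Prod>j\<in>{l<..N}. nb_fps (m j) j) n"
  using assms
proof (induction N rule: dec_induct)
  case base
  then show ?case by (simp add: tail_fps_def)
next
  case (step N)
  show ?case
  proof (cases "l \<le> N")
    case True
    then have "{l<..Suc N} = insert (Suc N) {l<..N}" by auto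
    then show ?thesis using step by (simp add: fps_nth_mult_nb_fps_low)
  next
    case False
    then have "{l<..Suc N} = {l<..N}" by auto
    then show ?thesis using step by simp
  qed
qed

lemma tail_fps_step: "tail_fps m l = nb_fps (m (Suc l)) (Suc l) * tail_fps m (Suc l)"
proof (rule fps_ext)
  fix n
  \<comment> \<open>Large enough for every coefficient up to n and for the factor l + 1 to
    occur.\<close>
  define N where "N = Suc (l + n)"
  have "fps_nth (tail_fps m l) n = fps_nth (\<Prod>j\<in>{l<..N}. nb_fps (m j) j) n"
    by (intro nth_tail_fps) (simp add: N_def)
  also have "{l<..N} = insert (Suc l) {Suc l<..N}" by (auto simp: N_def)
  also have "(\<Prod>j\<in>\<dots>. nb_fps (m j) j) = nb_fps (m (Suc l)) (Suc l) * (\<Prod>j\<in>{Suc l<..N}. nb_fps (m j) j)"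
    by simp
  also have "fps_nth \<dots> n = fps_nth (nb_fps (m (Suc l)) (Suc l) * tail_fps m (Suc l)) n"
    unfolding fps_mult_nth
    by (intro sum.cong refl arg_cong2[where f = "(*)"] nth_tail_fps[symmetric]) (simp add: N_def)
  finally show "fps_nth (tail_fps m l) n = fps_nth (nb_fps (m (Suc l)) (Suc l) * tail_fps m (Suc l)) n" .
qed

text \<open>For k \<ge> 1, the coefficient of x^k in x C' / C, where C = \<Prod> (1 - x^d)^(-m
  d).\<close>

definition divisor_sum :: "(nat \<Rightarrow> real) \<Rightarrow> nat \<Rightarrow> real" where
  "divisor_sum m k = (\<Sum>d | d dvd k. real d * m d)"

text \<open>Logarithmic derivatives add over the finite product of the factors up to n + 1, whose
  coefficients agree with those of the infinite product up to that degree. Factor j contributes j m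
  j at each positive multiple of j, hence the sum over divisors.\<close>

lemma tail_fps_0_eq_euler_coeff: "fps_nth (tail_fps m 0) n = euler_coeff (divisor_sum m) n"
proof (rule euler_coeff_unique)
  show "fps_nth (tail_fps m 0) 0 = 1" by (simp add: tail_fps_def)
next
  fix n
  define P where "P = (\<lambda>A. \<Prod>j\<in>A. nb_fps (m j) j)"
  define L where "L = (\<lambda>j. Abs_fps (\<lambda>n. if 0 < n \<and> j dvd n then m j * real j else 0))"
  have "fps_X * fps_deriv (P A) = P A * (\<Sum>j\<in>A. L j) \<and> fps_nth (\<Sum>j\<in>A. L j) 0 = 0"
    if "finite A" "0 \<notin> A" for A
    using that
  proof (induction A rule: finite_induct)
    case (insert j A)
    have PA: "P (insert j A) = nb_fps (m j) j * P A" using insert by (simp add: P_def)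
    have "fps_X * fps_deriv (P (insert j A)) =
        nb_fps (m j) j * (fps_X * fps_deriv (P A)) + (fps_X * fps_deriv (nb_fps (m j) j)) * P A"
      unfolding PA by (simp add: algebra_simps)
    also have "fps_X * fps_deriv (P A) = P A * (\<Sum>j\<in>A. L j)" using insert by simp
    also have "fps_X * fps_deriv (nb_fps (m j) j) = nb_fps (m j) j * L j"
      unfolding L_def using insert by (intro nb_fps_deriv) (auto intro: gr0I)
    finally show ?case using insert PA by (simp add: algebra_simps L_def)
  qed (simp add: P_def)
  from this[of "{0<..Suc n}"] fps_euler_coeff_rec[of "\<Sum>j\<in>{0<..Suc n}. L j" "P {0<..Suc n}"]
  have "real (Suc n) * fps_nth (P {0<..Suc n}) (Suc n) =
      (\<Sum>i\<le>n. fps_nth (\<Sum>j\<in>{0<..Suc n}. L j) (Suc i) * fps_nth (P {0<..Suc n}) (n - i))"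
    by auto
  moreover have "fps_nth (tail_fps m 0) k = fps_nth (P {0<..Suc n}) k" if "k \<le> Suc n" for k
    unfolding P_def using that by (rule nth_tail_fps)
  moreover have "fps_nth (\<Sum>j\<in>{0<..Suc n}. L j) (Suc i) = divisor_sum m (Suc i)" if "i \<le> n" for i
  proof -
    have "fps_nth (\<Sum>j\<in>{0<..Suc n}. L j) (Suc i) =
        (\<Sum>j\<in>{0<..Suc n}. if j dvd Suc i then real j * m j else 0)"
      by (simp add: fps_sum_nth L_def mult.commute cong: if_cong)
    also have "\<dots> = (\<Sum>j\<in>{0<..Suc n} \<inter> {j. j dvd Suc i}. real j * m j)"
      by (simp add: sum.inter_restrict)
    also have "{0<..Suc n} \<inter> {j. j dvd Suc i} = {j. j dvd Suc i}"
    proof (intro set_eqI)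
      fix j
      have "0 < j \<and> j \<le> Suc i" if "j dvd Suc i"
        using that dvd_imp_le[OF that] dvd_pos_nat[OF _ that] by simp
      then show "j \<in> {0<..Suc n} \<inter> {j. j dvd Suc i} \<longleftrightarrow> j \<in> {j. j dvd Suc i}"
        using \<open>i \<le> n\<close> by auto
    qed
    finally show ?thesis by (simp add: divisor_sum_def)
  qed
  ultimately show "real (Suc n) * fps_nth (tail_fps m 0) (Suc n) =
      (\<Sum>i\<le>n. divisor_sum m (Suc i) * fps_nth (tail_fps m 0) (n - i))"
    by simp
qed

text \<open>Passes from the formal series to its value: the coefficients sit at multiples of j, so
  the sum over n reindexes to the binomial series at x^j.\<close>

lemma nb_fps_sums:
  assumes j: "j > 0" and x: "0 < x" "x < 1"
  shows "summable (\<lambda>n. \<bar>fps_nth (nb_fps r j) n\<bar> * x ^ n)"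
    and "(\<Sum>n. fps_nth (nb_fps r j) n * x ^ n) = (1 - x ^ j) powr (-r)"
proof -
  define g where "g = (\<lambda>k. (r + real k - 1) gchoose k)"
  have sums: "(\<lambda>k. g k * y ^ k) sums (1 - y) powr (-r)" if "\<bar>y\<bar> < 1" for y
  proof -
    have "(\<lambda>n. ((-r) gchoose n) * (-y) ^ n) sums (1 + (-y)) powr (-r)"
      using that by (intro gen_binomial_real) auto
    also have "(\<lambda>n. ((-r) gchoose n) * (-y) ^ n) = (\<lambda>n. g n * y ^ n)"
    proof
      fix n
      have "((-1::real) ^ n) * (-y) ^ n = y ^ n" by (simp flip: power_mult_distrib)
      then show "((-r) gchoose n) * (-y) ^ n = g n * y ^ n"
        by (simp add: gbinomial_minus mult_ac g_def)
    qed
    finally show ?thesis by simp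
  qed
  have xj: "0 < x ^ j" "x ^ j < 1" using x j by (auto simp: power_less_one_iff)
  \<comment> \<open>\<open>powser_insidea\<close> gives absolute convergence strictly inside a point
    of convergence, here \<open>z\<close>.\<close>
  then obtain z where z: "x ^ j < z" "z < 1" using dense by blast
  have abs: "summable (\<lambda>k. \<bar>g k\<bar> * (x ^ j) ^ k)"
    using powser_insidea[of g z "x ^ j"] sums[of z] z xj by (auto simp: sums_iff abs_mult)
  have inj: "strict_mono (\<lambda>k. j * k)" using j by (auto simp: strict_mono_def)
  have out: "n \<notin> range (\<lambda>k. j * k) \<Longrightarrow> fps_nth (nb_fps r j) n = 0" for n
    using j by (auto simp: nth_nb_fps elim!: dvdE)
  have in': "fps_nth (nb_fps r j) (j * k) = g k" for k using j by (simp add: nth_nb_fps g_def)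
  show "summable (\<lambda>n. \<bar>fps_nth (nb_fps r j) n\<bar> * x ^ n)"
    by (subst summable_mono_reindex[OF inj, symmetric]) (use out abs in \<open>auto simp: in' power_mult\<close>)
  have "(\<Sum>n. fps_nth (nb_fps r j) n * x ^ n) = (\<Sum>k. fps_nth (nb_fps r j) (j * k) * x ^ (j * k))"
    by (subst suminf_mono_reindex[OF inj, symmetric]) (use out in auto)
  also have "\<dots> = (1 - x ^ j) powr (-r)"
    using sums[of "x ^ j"] xj by (simp add: in' power_mult sums_iff)
  finally show "(\<Sum>n. fps_nth (nb_fps r j) n * x ^ n) = (1 - x ^ j) powr (-r)" .
qed

text \<open>Induction on l: multiplying by (1 - x^(l + 1))^(m (l + 1)) passes from one tail to the
  next, and \<open>convolution_ratio_tendsto\<close> evaluates this factor at \<rho>. Because the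
  limit \<open>A l\<close> is positive, tail l inherits eventual positivity and the ratio limit
  \<rho> from tail 0.\<close>

lemma tail_fps_ratio:
  assumes \<rho>: "0 < \<rho>" "\<rho> < 1"
    and pos: "\<And>n. fps_nth (tail_fps m 0) n > 0"
    and lim: "(\<lambda>n. fps_nth (tail_fps m 0) n / fps_nth (tail_fps m 0) (Suc n)) \<longlonglongrightarrow> \<rho>"
  shows "(\<lambda>n. fps_nth (tail_fps m l) n / fps_nth (tail_fps m 0) n) \<longlonglongrightarrow> (\<Prod>j=1..l. (1 - \<rho> ^ j) powr m j)"
proof -
  define c where "c = (\<lambda>l. fps_nth (tail_fps m l))"
  define A where "A = (\<lambda>l. \<Prod>j=1..l. (1 - \<rho> ^ j) powr m j)"
  have A_pos: "A l > 0" for l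
    unfolding A_def
  proof (rule prod_pos)
    fix j assume "j \<in> {1..l}"
    then have "\<rho> ^ j < 1" using \<rho> by (simp add: power_less_one_iff)
    then show "0 < (1 - \<rho> ^ j) powr m j" by simp
  qed
  have "(\<lambda>n. c l n / c 0 n) \<longlonglongrightarrow> A l" for l
  proof (induction l)
    case 0
    show ?case using pos by (simp add: c_def A_def less_imp_neq[symmetric])
  next
    case (Suc l)
    have ev: "\<forall>\<^sub>F n in sequentially. c l n > 0"
      using order_tendstoD(1)[OF Suc A_pos]
    proof eventually_elim
      case (elim n)
      then show ?case using pos[of n] by (simp add: c_def zero_less_divide_iff)
    qed
    have ratio: "(\<lambda>n. c l n / c l (Suc n)) \<longlonglongrightarrow> \<rho>"
    proof -
      have "(\<lambda>n. (c l n / c 0 n) / (c l (Suc n) / c 0 (Suc n)) * (c 0 n / c 0 (Suc n))) \<longlonglongrightarrow> A l / A l * \<rho>"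
        using lim A_pos[of l] by (intro tendsto_intros Suc LIMSEQ_Suc) (auto simp: c_def)
      moreover have "(c l n / c 0 n) / (c l (Suc n) / c 0 (Suc n)) * (c 0 n / c 0 (Suc n)) = c l n / c l (Suc n)" for n
        using pos[of n] pos[of "Suc n"] by (simp add: c_def)
      ultimately show ?thesis using A_pos[of l] by simp
    qed
    obtain \<sigma> where \<sigma>: "\<rho> < \<sigma>" "\<sigma> < 1" using dense \<rho> by blast
    have "nb_fps (- m (Suc l)) (Suc l) * tail_fps m l =
        (nb_fps (m (Suc l)) (Suc l) * nb_fps (- m (Suc l)) (Suc l)) * tail_fps m (Suc l)"
      by (subst tail_fps_step[of m l]) (simp only: mult_ac)
    then have "tail_fps m (Suc l) = nb_fps (- m (Suc l)) (Suc l) * tail_fps m l"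
      by (simp add: nb_fps_mult_uminus)
    then have c_Suc: "c (Suc l) n = (\<Sum>k\<le>n. fps_nth (nb_fps (- m (Suc l)) (Suc l)) k * c l (n - k))" for n
      by (simp add: c_def fps_mult_nth atMost_atLeast0)
    have "(\<lambda>n. c (Suc l) n / c l n) \<longlonglongrightarrow> (\<Sum>k. fps_nth (nb_fps (- m (Suc l)) (Suc l)) k * \<rho> ^ k)"
      unfolding c_Suc using \<rho> \<sigma> by (intro convolution_ratio_tendsto[OF ev ratio \<sigma>(1)] nb_fps_sums) auto
    also have "(\<Sum>k. fps_nth (nb_fps (- m (Suc l)) (Suc l)) k * \<rho> ^ k) = (1 - \<rho> ^ Suc l) powr m (Suc l)"
      using \<rho> by (subst nb_fps_sums) auto
    finally have "(\<lambda>n. c (Suc l) n / c l n * (c l n / c 0 n)) \<longlonglongrightarrow> (1 - \<rho> ^ Suc l) powr m (Suc l) * A l"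
      by (intro tendsto_mult Suc)
    moreover have "\<forall>\<^sub>F n in sequentially. c (Suc l) n / c l n * (c l n / c 0 n) = c (Suc l) n / c 0 n"
      using ev by eventually_elim auto
    ultimately have "(\<lambda>n. c (Suc l) n / c 0 n) \<longlonglongrightarrow> (1 - \<rho> ^ Suc l) powr m (Suc l) * A l"
      by (rule Lim_transform_eventually)
    then show ?case by (simp add: A_def mult.commute)
  qed
  then show ?thesis by (simp add: c_def A_def)
qed

section \<open>Weak convergence of the initial laws\<close>

lemma pmf_map_add_pair_pmf:
  fixes P Q :: "nat pmf"
  shows "pmf (map_pmf (\<lambda>(x, y). x + y) (pair_pmf P Q)) n = (\<Sum>i\<le>n. pmf P i * pmf Q (n - i))"
proof -
  have "(\<lambda>(x, y). x + y) -` {n} = (\<lambda>i. (i, n - i)) ` {..n}"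
    by (auto simp: image_iff)
  then have "pmf (map_pmf (\<lambda>(x, y). x + y) (pair_pmf P Q)) n =
      measure (pair_pmf P Q) ((\<lambda>i. (i, n - i)) ` {..n})"
    by (simp add: pmf_map)
  also have "\<dots> = (\<Sum>i\<le>n. pmf P i * pmf Q (n - i))"
    by (simp add: measure_measure_pmf_finite sum.reindex inj_on_def pmf_pair)
  finally show ?thesis .
qed

lemma pmf_map_mult_nat:
  fixes P :: "nat pmf"
  assumes "a > 0"
  shows "pmf (map_pmf (\<lambda>x. a * x) P) n = (if a dvd n then pmf P (n div a) else 0)"
proof -
  have "(\<lambda>x. a * x) -` {n} = (if a dvd n then {n div a} else {})"
    using assms by auto
  then show ?thesis by (simp add: pmf_map measure_pmf_single)
qed

lemma measure_cond_pmf: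
  assumes "set_pmf p \<inter> S \<noteq> {}"
  shows "measure (cond_pmf p S) A = measure p (S \<inter> A) / measure p S"
proof -
  have "measure p S > 0" using assms by (simp add: measure_measure_pmf_not_zero zero_less_measure_iff)
  then show ?thesis
    using assms
    by (simp add: cond_pmf.rep_eq measure_def[of "uniform_measure _ _"] emeasure_uniform_measure
        measure_pmf.emeasure_eq_measure divide_ennreal)
qed

text \<open>Scheffe's lemma: pointwise convergence of probability mass functions to a probability
  mass function is convergence in L^1, which controls expectations of bounded functions.\<close>

lemma pmf_expectation_tendsto:
  fixes f :: "'a \<Rightarrow> real"
  assumes lim: "\<And>x. (\<lambda>n. pmf (P n) x) \<longlonglongrightarrow> pmf Q x" and bd: "\<And>x. \<bar>f x\<bar> \<le> B"
  shows "(\<lambda>n. measure_pmf.expectation (P n) f) \<longlonglongrightarrow> measure_pmf.expectation Q f"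
proof -
  let ?C = "count_space (UNIV :: 'a set)"
  have ex: "measure_pmf.expectation R f = (\<integral>x. pmf R x * f x \<partial>?C)" for R
    unfolding measure_pmf_eq_density by (subst integral_density) auto
  have int: "integrable ?C (\<lambda>x. pmf R x * f x)" for R
  proof (rule Bochner_Integration.integrable_bound)
    show "integrable ?C (\<lambda>x. pmf R x * B)" by (intro integrable_mult_left integrable_pmf)
    show "AE x in ?C. norm (pmf R x * f x) \<le> norm (pmf R x * B)"
      using order_trans[OF bd abs_ge_self] by (auto simp: abs_mult intro!: mult_left_mono)
  qed auto
  have nn1: "(\<integral>\<^sup>+x. norm (pmf R x) \<partial>?C) = 1" for R :: "'a pmf"
    by (simp add: nn_integral_pmf)
  have "(\<lambda>n. \<integral>\<^sup>+x. norm (pmf (P n) x - pmf Q x) \<partial>?C) \<longlonglongrightarrow> 0"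
    by (rule Scheffe_lemma2) (auto simp: nn1[simplified] intro: lim integrable_pmf)
  also have "(\<lambda>n. \<integral>\<^sup>+x. norm (pmf (P n) x - pmf Q x) \<partial>?C) =
      (\<lambda>n. ennreal (\<integral>x. norm (pmf (P n) x - pmf Q x) \<partial>?C))"
    by (intro ext nn_integral_eq_integral integrable_norm Bochner_Integration.integrable_diff integrable_pmf) auto
  finally have 0: "(\<lambda>n. \<integral>x. \<bar>pmf (P n) x - pmf Q x\<bar> \<partial>?C) \<longlonglongrightarrow> 0"
    by (subst (asm) ennreal_tendsto_0_iff) auto
  have B0: "B \<ge> 0" using bd[of undefined] by linarith
  have "(\<lambda>n. measure_pmf.expectation (P n) f - measure_pmf.expectation Q f) \<longlonglongrightarrow> 0"
  proof (rule Lim_null_comparison)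
    show "(\<lambda>n. (\<integral>x. \<bar>pmf (P n) x - pmf Q x\<bar> \<partial>?C) * B) \<longlonglongrightarrow> 0"
      using tendsto_mult_right[OF 0, of B] by simp
    have "norm (measure_pmf.expectation (P n) f - measure_pmf.expectation Q f)
        \<le> (\<integral>x. \<bar>pmf (P n) x - pmf Q x\<bar> \<partial>?C) * B" for n
    proof -
      have ii: "integrable ?C (\<lambda>x. \<bar>pmf (P n) x - pmf Q x\<bar>)"
        by (intro integrable_abs Bochner_Integration.integrable_diff integrable_pmf)
      have "measure_pmf.expectation (P n) f - measure_pmf.expectation Q f =
          (\<integral>x. pmf (P n) x * f x - pmf Q x * f x \<partial>?C)"
        unfolding ex by (rule Bochner_Integration.integral_diff[symmetric, OF int int])
      also have "norm \<dots> \<le> (\<integral>x. norm (pmf (P n) x * f x - pmf Q x * f x) \<partial>?C)"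
        by (rule integral_norm_bound)
      also have "\<dots> \<le> (\<integral>x. \<bar>pmf (P n) x - pmf Q x\<bar> * B \<partial>?C)"
      proof (rule integral_mono)
        show "integrable ?C (\<lambda>x. norm (pmf (P n) x * f x - pmf Q x * f x))"
          by (intro integrable_norm Bochner_Integration.integrable_diff int)
        show "integrable ?C (\<lambda>x. \<bar>pmf (P n) x - pmf Q x\<bar> * B)"
          by (intro integrable_mult_left ii)
        show "norm (pmf (P n) x * f x - pmf Q x * f x) \<le> \<bar>pmf (P n) x - pmf Q x\<bar> * B" for x
          using bd by (simp add: left_diff_distrib[symmetric] abs_mult mult_left_mono)
      qed
      finally show ?thesis by simp
    qed
    then show "\<forall>\<^sub>F n in sequentially. norm (measure_pmf.expectation (P n) f - measure_pmf.expectation Q f)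
        \<le> (\<integral>x. \<bar>pmf (P n) x - pmf Q x\<bar> \<partial>?C) * B" by simp
  qed
  then show ?thesis by (simp add: LIM_zero_iff)
qed

text \<open>Coordinates outside {1..l} become 0 instead of \<open>undefined\<close>, which matches
  the default value given to \<open>Pi_pmf\<close>.\<close>

definition initial_pmf :: "nat \<Rightarrow> (nat \<Rightarrow> nat) pmf \<Rightarrow> (nat \<Rightarrow> nat) pmf" where
  "initial_pmf l K = map_pmf (\<lambda>k j. if j \<in> {1..l} then k j else 0) K"

lemma integral_initial_law:
  fixes f :: "(nat \<Rightarrow> real) \<Rightarrow> real"
  assumes "f \<in> borel_measurable (\<Pi>\<^sub>M j\<in>{1..l}. borel)"
  shows "(\<integral>x. f x \<partial>initial_law K l) =
    measure_pmf.expectation K (\<lambda>k. f (\<lambda>j\<in>{1..l}. real (k j)))"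
  unfolding initial_law_def
  using assms by (subst integral_distr) (auto simp: space_PiM)

text \<open>On integer vectors a bounded continuous test function is just a bounded function, so
  pointwise convergence of the masses suffices by \<open>pmf_expectation_tendsto\<close>. The limit
  law is the image of \<open>Q l\<close>.\<close>

lemma convergent_structureI:
  assumes lim: "\<And>l x. (\<lambda>n. pmf (initial_pmf l (K n)) x) \<longlonglongrightarrow> pmf (Q l) x"
  shows "convergent_structure K"
  unfolding convergent_structure_def
proof (intro allI impI exI conjI)
  fix l :: nat
  show "prob_space (initial_law (Q l) l)"
    unfolding initial_law_def
    by (intro measure_pmf.prob_space_distr) (auto simp: space_PiM)
  show "sets (initial_law (Q l) l) = sets (\<Pi>\<^sub>M j\<in>{1..l}. (borel :: real measure))"
    by (simp add: initial_law_def)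
  show "weakly_converges l (\<lambda>n. initial_law (K n) l) (initial_law (Q l) l)"
    unfolding weakly_converges_def
  proof (intro allI impI, elim conjE)
    fix f assume f: "continuous_map (product_topology (\<lambda>_. euclideanreal) {1..l}) euclideanreal f"
      and "bounded (f ` (\<Pi>\<^sub>E j\<in>{1..l}. UNIV))"
    then obtain B where B: "\<And>x. x \<in> (\<Pi>\<^sub>E j\<in>{1..l}. UNIV) \<Longrightarrow> \<bar>f x\<bar> \<le> B"
      by (auto simp: bounded_iff)
    note meas = continuous_map_measurable_PiM[OF f]
    define g where "g = (\<lambda>k :: nat \<Rightarrow> nat. f (\<lambda>j\<in>{1..l}. real (k j)))"
    have g: "\<bar>g k\<bar> \<le> B" for k unfolding g_def by (intro B) auto
    have "measure_pmf.expectation (K n) g = measure_pmf.expectation (initial_pmf l (K n)) g" for n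
      unfolding initial_pmf_def integral_map_pmf g_def
      by (intro Bochner_Integration.integral_cong refl arg_cong[where f = f]) auto
    moreover have "(\<lambda>n. measure_pmf.expectation (initial_pmf l (K n)) g)
        \<longlonglongrightarrow> measure_pmf.expectation (Q l) g"
      by (rule pmf_expectation_tendsto[OF lim g])
    ultimately show "(\<lambda>n. \<integral>x. f x \<partial>initial_law (K n) l) \<longlonglongrightarrow> (\<integral>x. f x \<partial>initial_law (Q l) l)"
      by (simp add: integral_initial_law[OF meas] g_def)
  qed
qed

text \<open>The limit law puts little mass on large values of the first coordinate, and weak
  convergence, tested on one continuous function, carries this bound to all late laws.\<close>

lemma convergent_structure_tight:
  assumes "convergent_structure K"
  shows "\<exists>M. \<forall>\<^sub>F n in sequentially. measure_pmf.prob (K n) {k. k 1 > M} < 1 / 2"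
proof -
  \<comment> \<open>A continuous ramp from 0 at |x 1| = M to 1 at |x 1| = M + 1. On natural numbers
    it is the indicator of k 1 > M.\<close>
  define f where "f = (\<lambda>(M::nat) (x :: nat \<Rightarrow> real). min 1 (max 0 (\<bar>x 1\<bar> - real M)))"
  obtain \<nu> where \<nu>: "prob_space \<nu>" "sets \<nu> = sets (\<Pi>\<^sub>M j\<in>{1..1}. (borel :: real measure))"
    and w: "weakly_converges 1 (\<lambda>n. initial_law (K n) 1) \<nu>"
    using assms unfolding convergent_structure_def by blast
  interpret prob_space \<nu> by fact
  have cont: "continuous_map (product_topology (\<lambda>_. euclideanreal) {1..1}) euclideanreal (f M)" for M
    unfolding f_def
    by (intro continuous_map_real_min continuous_map_real_max continuous_map_diff continuous_map_real_abs)
       (auto intro: continuous_map_product_projection)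
  have meas: "f M \<in> borel_measurable (\<Pi>\<^sub>M j\<in>{1..1}. borel)" for M
    by (rule continuous_map_measurable_PiM[OF cont])
  have "bounded (f M ` A)" for M A
    by (intro boundedI[of _ 1]) (auto simp: f_def)
  then have lim: "(\<lambda>n. \<integral>x. f M x \<partial>initial_law (K n) 1) \<longlonglongrightarrow> (\<integral>x. f M x \<partial>\<nu>)" for M
    using w cont unfolding weakly_converges_def by blast
  have "(\<lambda>M. \<integral>x. f M x \<partial>\<nu>) \<longlonglongrightarrow> (\<integral>x. 0 \<partial>\<nu>)"
  proof (rule integral_dominated_convergence[where w = "\<lambda>_. 1"])
    show "f M \<in> borel_measurable \<nu>" for M
      using meas[of M] measurable_cong_sets[OF \<nu>(2) refl] by blast
    have "(\<lambda>M. f M x) \<longlonglongrightarrow> 0" for x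
    proof (rule tendsto_eventually)
      obtain N where "\<bar>x 1\<bar> \<le> real N" using real_arch_simple by blast
      then show "\<forall>\<^sub>F M in sequentially. f M x = 0"
        by (intro eventually_mono[OF eventually_ge_at_top[of N]]) (simp add: f_def)
    qed
    then show "AE x in \<nu>. (\<lambda>M. f M x) \<longlonglongrightarrow> 0" by simp
  qed (auto simp: f_def)
  then have "(\<lambda>M. \<integral>x. f M x \<partial>\<nu>) \<longlonglongrightarrow> 0" by simp
  then have "\<forall>\<^sub>F M in sequentially. (\<integral>x. f M x \<partial>\<nu>) < 1 / 2"
    by (rule order_tendstoD) simp
  then obtain M where M: "(\<integral>x. f M x \<partial>\<nu>) < 1 / 2"
    by (auto simp: eventually_sequentially)
  have "\<forall>\<^sub>F n in sequentially. (\<integral>x. f M x \<partial>initial_law (K n) 1) < 1 / 2"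
    by (rule order_tendstoD(2)[OF lim M])
  then have "\<forall>\<^sub>F n in sequentially. measure_pmf.prob (K n) {k. k 1 > M} < 1 / 2"
  proof eventually_elim
    case (elim n)
    have "measure_pmf.prob (K n) {k. k 1 > M} = measure_pmf.expectation (K n) (indicator {k. k 1 > M})"
      by simp
    also have "\<dots> \<le> measure_pmf.expectation (K n) (\<lambda>k. f M (\<lambda>j\<in>{1..1}. real (k j)))"
      by (intro integral_mono measure_pmf.integrable_const_bound[where B = 1])
         (auto simp: f_def indicator_def)
    also have "\<dots> = (\<integral>x. f M x \<partial>initial_law (K n) 1)" by (rule integral_initial_law[OF meas, symmetric])
    finally show ?case using elim by simp
  qed
  then show ?thesis by blast
qed

section \<open>The multiset process\<close>

lemma nb_coeff_nonneg: "m > 0 \<Longrightarrow> (m + real k - 1) gchoose k \<ge> 0"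
  by (auto simp: gbinomial_pochhammer' intro!: divide_nonneg_nonneg pochhammer_nonneg)

text \<open>The rising factorial increases with m, and at m = 1 it equals
  \<open>fact k\<close>.\<close>

lemma nb_coeff_ge_1:
  assumes "m \<ge> 1"
  shows "(m + real k - 1) gchoose k \<ge> 1"
proof -
  have "pochhammer (1::real) k \<le> pochhammer m k"
    unfolding pochhammer_prod using assms by (intro prod_mono) auto
  then show ?thesis by (simp add: gbinomial_pochhammer' pochhammer_fact[symmetric])
qed

lemma prod_nb_fps_nonneg:
  assumes "finite A" "\<And>j. j \<in> A \<Longrightarrow> j > 0 \<and> m j > 0"
  shows "fps_nth (\<Prod>j\<in>A. nb_fps (m j) j) n \<ge> 0"
  using assms
proof (induction A arbitrary: n rule: finite_induct)
  case empty
  then show ?case by simp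
next
  case (insert j A)
  then show ?case
    by (auto simp: fps_mult_nth nth_nb_fps intro!: sum_nonneg mult_nonneg_nonneg nb_coeff_nonneg)
qed

locale multiset_parameters =
  fixes m :: "nat \<Rightarrow> real"
  assumes m_ge_1: "\<And>j. j \<ge> 1 \<Longrightarrow> m j \<ge> 1"
begin

lemma m_pos: "j \<ge> 1 \<Longrightarrow> m j > 0"
  using m_ge_1[of j] by linarith

lemma tail_nonneg: "fps_nth (tail_fps m l) n \<ge> 0"
  unfolding tail_fps_def by (auto intro!: prod_nb_fps_nonneg m_pos)

lemma divisor_sum_ge: "k \<ge> 1 \<Longrightarrow> real k * m k \<le> divisor_sum m k"
  unfolding divisor_sum_def
  by (rule member_le_sum) (auto intro!: mult_nonneg_nonneg less_imp_le[OF m_pos] simp: dvd_pos_nat Suc_le_eq)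

lemma divisor_sum_pos: "k \<ge> 1 \<Longrightarrow> divisor_sum m k > 0"
  using divisor_sum_ge[of k] m_pos[of k] by (auto intro: less_le_trans[rotated])

lemma total_pos: "fps_nth (tail_fps m 0) n > 0"
  unfolding tail_fps_0_eq_euler_coeff by (rule euler_coeff_pos[OF divisor_sum_pos])

context
  fixes p :: real
  assumes p: "0 < p" "p < 1"
begin

abbreviation "Z \<equiv> \<lambda>j. NB_pmf (m j) (p ^ j)"

lemma pmf_Z:
  "j \<ge> 1 \<Longrightarrow> pmf (Z j) k = (1 - p ^ j) powr m j * ((m j + real k - 1) gchoose k) * p ^ (j * k)"
  using p m_pos[of j] by (subst pmf_NB) (auto simp: power_less_one_iff power_mult)

text \<open>By independence the generating function of the weighted sum is a product, and the factor
  of \<open>j * Z j\<close> is (1 - p^j)^(m j) times \<open>nb_fps (m j) j\<close> at p times the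
  variable. Adding one index is a convolution.\<close>

lemma pmf_weighted_sum:
  assumes "finite A" "0 \<notin> A"
  shows "pmf (map_pmf (\<lambda>k. \<Sum>j\<in>A. j * k j) (Pi_pmf A 0 Z)) n =
    (\<Prod>j\<in>A. (1 - p ^ j) powr m j) * p ^ n * fps_nth (\<Prod>j\<in>A. nb_fps (m j) j) n"
  using assms
proof (induction A arbitrary: n rule: finite_induct)
  case empty
  show ?case by (simp add: indicator_def)
next
  case (insert a A)
  then have a: "a \<ge> 1" by (auto simp: Suc_le_eq intro: gr0I)
  define W where "W = (\<Prod>j\<in>A. (1 - p ^ j) powr m j)"
  define F where "F = (\<Prod>j\<in>A. nb_fps (m j) j)"
  define S where "S = map_pmf (\<lambda>k. \<Sum>j\<in>A. j * k j) (Pi_pmf A 0 Z)"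
  have S: "pmf S i = W * p ^ i * fps_nth F i" for i
    unfolding S_def W_def F_def using insert by auto
  have upd: "(\<Sum>j\<in>insert a A. j * (k(a := y)) j) = a * y + (\<Sum>j\<in>A. j * k j)" for k :: "nat \<Rightarrow> nat" and y
    using insert by (auto intro!: sum.cong)
  have "map_pmf (\<lambda>k. \<Sum>j\<in>insert a A. j * k j) (Pi_pmf (insert a A) 0 Z) =
      map_pmf (\<lambda>(y, k). a * y + (\<Sum>j\<in>A. j * k j)) (pair_pmf (Z a) (Pi_pmf A 0 Z))"
    using insert by (simp only: Pi_pmf_insert map_pmf_comp case_prod_unfold upd fst_conv snd_conv not_False_eq_True)
  also have "\<dots> = map_pmf (\<lambda>(x, y). x + y) (pair_pmf (map_pmf (\<lambda>x. a * x) (Z a)) S)"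
    unfolding S_def by (simp add: map_pair[symmetric] map_pmf_comp case_prod_unfold)
  finally have "pmf (map_pmf (\<lambda>k. \<Sum>j\<in>insert a A. j * k j) (Pi_pmf (insert a A) 0 Z)) n =
      (\<Sum>i\<le>n. pmf (map_pmf (\<lambda>x. a * x) (Z a)) i * pmf S (n - i))"
    by (simp only: pmf_map_add_pair_pmf)
  also have "\<dots> = (\<Sum>i\<le>n. (1 - p ^ a) powr m a * W * p ^ n * (fps_nth (nb_fps (m a) a) i * fps_nth F (n - i)))"
  proof (intro sum.cong refl)
    fix i assume "i \<in> {..n}"
    then have "p ^ n = p ^ i * p ^ (n - i)" by (simp flip: power_add)
    then show "pmf (map_pmf (\<lambda>x. a * x) (Z a)) i * pmf S (n - i) =
        (1 - p ^ a) powr m a * W * p ^ n * (fps_nth (nb_fps (m a) a) i * fps_nth F (n - i))"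
      using a by (simp add: pmf_map_mult_nat pmf_Z nth_nb_fps S)
  qed
  also have "\<dots> = (1 - p ^ a) powr m a * W * p ^ n * fps_nth (nb_fps (m a) a * F) n"
    by (simp add: sum_distrib_left fps_mult_nth atMost_atLeast0)
  finally show ?case using insert by (simp add: W_def F_def)
qed

text \<open>Independence splits the vector at l. Numerator and denominator both carry p^n and
  \<Prod> (1 - p^j)^(m j) over j \<le> n; these cancel, so p disappears from the result.\<close>

lemma pmf_initial_multiset:
  assumes l: "l \<le> n" and x: "\<And>j. j \<notin> {1..l} \<Longrightarrow> x j = 0"
  defines "s \<equiv> \<Sum>j=1..l. j * x j"
  shows "pmf (initial_pmf l (multiset_process m p n)) x =
    (if s \<le> n then (\<Prod>j=1..l. (m j + real (x j) - 1) gchoose x j) *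
       fps_nth (tail_fps m l) (n - s) / fps_nth (tail_fps m 0) n else 0)"
proof -
  define P where "P = Pi_pmf {1..n} 0 Z"
  define E where "E = {k :: nat \<Rightarrow> nat. (\<Sum>j=1..n. j * k j) = n}"
  define W where "W = (\<lambda>A. \<Prod>j\<in>A. (1 - p ^ j) powr m j)"
  have W_pos: "W A > 0" if "A \<subseteq> {1..}" for A
    unfolding W_def
  proof (rule prod_pos)
    fix j assume "j \<in> A"
    then have "p ^ j < 1" using p that by (auto simp: power_less_one_iff)
    then show "0 < (1 - p ^ j) powr m j" by simp
  qed
  have Int: "set_pmf P \<inter> E \<noteq> {}"
    unfolding P_def E_def using m_ge_1 p by (rule multiset_event_possible)
  have iv: "{0<..n} = {Suc 0..n}" by auto
  have "measure P E = pmf (map_pmf (\<lambda>k. \<Sum>j\<in>{1..n}. j * k j) P) n"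
    by (simp add: pmf_map E_def vimage_def)
  also have "\<dots> = W {1..n} * p ^ n * fps_nth (tail_fps m 0) n"
    unfolding P_def W_def by (subst pmf_weighted_sum) (auto simp: nth_tail_fps[of n n] iv)
  finally have mE: "measure P E = W {1..n} * p ^ n * fps_nth (tail_fps m 0) n" .

  define restr where "restr = (\<lambda>(k :: nat \<Rightarrow> nat) j. if j \<in> {1..l} then k j else 0)"
  define P1 P2 where "P1 = Pi_pmf {1..l} 0 Z" and "P2 = Pi_pmf {l<..n} 0 Z"
  define S where "S = map_pmf (\<lambda>k. \<Sum>j\<in>{l<..n}. j * k j) P2"
  have split: "{1..n} = {1..l} \<union> {l<..n}" using l by auto
  have PP: "P = map_pmf (\<lambda>(f, g) j. if j \<in> {1..l} then f j else g j) (pair_pmf P1 P2)"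
    unfolding P_def P1_def P2_def split by (rule Pi_pmf_union) auto
  have P1_supp: "restr f = f" if "f \<in> set_pmf P1" for f
    using that set_Pi_pmf_subset[of "{1..l}" 0 Z] by (auto simp: P1_def restr_def fun_eq_iff)
  have pmf_S: "pmf S i = W {l<..n} * p ^ i * fps_nth (tail_fps m l) i" if "i \<le> n" for i
    unfolding S_def P2_def W_def nth_tail_fps[OF that] by (rule pmf_weighted_sum) auto

  have "measure P (E \<inter> {k. restr k = x}) = measure (pair_pmf P1 S) {(f, t). f = x \<and> s + t = n}"
  proof -
    have "measure P (E \<inter> {k. restr k = x}) =
        measure (pair_pmf P1 P2) {(f, g). restr f = x \<and> (\<Sum>j=1..l. j * f j) + (\<Sum>j\<in>{l<..n}. j * g j) = n}"
    proof -
      have "(\<Sum>j=1..n. j * (if j \<in> {1..l} then f j else g j)) =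
          (\<Sum>j=1..l. j * f j) + (\<Sum>j\<in>{l<..n}. j * g j)" for f g :: "nat \<Rightarrow> nat"
      proof -
        have "(\<Sum>j=1..n. j * (if j \<in> {1..l} then f j else g j)) =
            (\<Sum>j=1..l. j * (if j \<in> {1..l} then f j else g j)) +
            (\<Sum>j\<in>{l<..n}. j * (if j \<in> {1..l} then f j else g j))"
          unfolding split by (rule sum.union_disjoint) auto
        also have "\<dots> = (\<Sum>j=1..l. j * f j) + (\<Sum>j\<in>{l<..n}. j * g j)"
          by (intro arg_cong2[where f = "(+)"] sum.cong) auto
        finally show ?thesis .
      qed
      then show ?thesis
        unfolding PP measure_map_pmf by (intro arg_cong[where f = "measure _"]) (auto simp: E_def restr_def fun_eq_iff)
    qed
    \<comment> \<open>Restricting to {1..l} changes nothing on the support of \<open>P1\<close>, so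
      the two events differ by a null set only.\<close>
    also have "\<dots> = measure (pair_pmf P1 P2) {(f, g). f = x \<and> s + (\<Sum>j\<in>{l<..n}. j * g j) = n}"
    proof (rule measure_prob_cong_0)
      fix y assume y: "y \<in> {(f, g). restr f = x \<and> (\<Sum>j=1..l. j * f j) + (\<Sum>j\<in>{l<..n}. j * g j) = n} -
          {(f, g). f = x \<and> s + (\<Sum>j\<in>{l<..n}. j * g j) = n}"
      then have "fst y \<notin> set_pmf P1" using P1_supp by (auto simp: s_def)
      then show "pmf (pair_pmf P1 P2) y = 0" by (cases y) (simp add: pmf_pair set_pmf_iff)
    next
      fix y assume y: "y \<in> {(f, g). f = x \<and> s + (\<Sum>j\<in>{l<..n}. j * g j) = n} -
          {(f, g). restr f = x \<and> (\<Sum>j=1..l. j * f j) + (\<Sum>j\<in>{l<..n}. j * g j) = n}"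
      have "restr x = x" using x by (auto simp: restr_def fun_eq_iff)
      with y show "pmf (pair_pmf P1 P2) y = 0" by (auto simp: s_def)
    qed
    also have "\<dots> = measure (pair_pmf P1 S) {(f, t). f = x \<and> s + t = n}"
      unfolding S_def pair_map_pmf2 measure_map_pmf by (intro arg_cong[where f = "measure _"]) auto
    finally show ?thesis .
  qed
  also have "\<dots> = (if s \<le> n then pmf P1 x * pmf S (n - s) else 0)"
  proof -
    have "{(f, t). f = x \<and> s + t = n} = (if s \<le> n then {(x, n - s)} else {})" by auto
    then show ?thesis by (simp add: measure_pmf_single pmf_pair)
  qed
  also have "pmf P1 x = W {1..l} * (\<Prod>j=1..l. (m j + real (x j) - 1) gchoose x j) * p ^ s"
  proof -
    have "pmf P1 x = (\<Prod>j=1..l. pmf (Z j) (x j))"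
      unfolding P1_def using x by (subst pmf_Pi') auto
    also have "\<dots> = (\<Prod>j=1..l. (1 - p ^ j) powr m j * ((m j + real (x j) - 1) gchoose x j) * p ^ (j * x j))"
      by (intro prod.cong refl pmf_Z) auto
    finally show ?thesis by (simp add: prod.distrib W_def power_sum s_def)
  qed
  finally have mEx: "measure P (E \<inter> {k. restr k = x}) = (if s \<le> n then
      W {1..l} * (\<Prod>j=1..l. (m j + real (x j) - 1) gchoose x j) * p ^ s * pmf S (n - s) else 0)" .

  have "pmf (initial_pmf l (multiset_process m p n)) x = measure (cond_pmf P E) {k. restr k = x}"
    by (simp add: initial_pmf_def multiset_process_def P_def E_def pmf_map restr_def vimage_def)
  also have "\<dots> = measure P (E \<inter> {k. restr k = x}) / measure P E" by (rule measure_cond_pmf[OF Int])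
  finally have eq: "pmf (initial_pmf l (multiset_process m p n)) x =
      measure P (E \<inter> {k. restr k = x}) / measure P E" .
  show ?thesis
  proof (cases "s \<le> n")
    case True
    have "W {1..n} = W {1..l} * W {l<..n}"
      unfolding W_def split by (rule prod.union_disjoint) auto
    moreover have "p ^ n = p ^ s * p ^ (n - s)" using True by (simp flip: power_add)
    moreover have "W {1..l} > 0" "W {l<..n} > 0" by (auto intro!: W_pos)
    ultimately show ?thesis
      unfolding eq mE mEx using True p total_pos[of n]
      by (simp add: pmf_S field_simps)
  qed (simp add: eq mEx)
qed

text \<open>The left-hand side times \<Prod> (1 - p^j)^(m j) is the probability that the weighted
  sum equals n, hence at most 1. The bound - ln (1 - q) \<le> q / (1 - q) with q = p^j \<le> p
  estimates the product. The divergence proof applies this at an auxiliary point x in place of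
  p.\<close>

lemma total_power_le:
  "fps_nth (tail_fps m 0) n * p ^ n \<le> exp (\<Sum>j=1..n. m j * p ^ j / (1 - p))"
proof -
  define E where "E = (\<Sum>j=1..n. m j * p ^ j / (1 - p))"
  define W where "W = (\<Prod>j\<in>{1..n}. (1 - p ^ j) powr m j)"
  have iv: "{0<..n} = {Suc 0..n}" by auto
  have W1: "W * p ^ n * fps_nth (tail_fps m 0) n \<le> 1"
    using pmf_weighted_sum[of "{0<..n}" n] pmf_le_1[of "map_pmf (\<lambda>k. \<Sum>j\<in>{0<..n}. j * k j) (Pi_pmf {0<..n} 0 Z)" n]
    by (simp add: nth_tail_fps[of n n] W_def iv)
  have WE: "exp (- E) \<le> W"
    unfolding W_def E_def sum_negf[symmetric] exp_sum[OF finite_atLeastAtMost]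
  proof (rule prod_mono, intro conjI)
    fix j assume "j \<in> {1..n}"
    then have j: "j \<ge> 1" by simp
    then have q: "0 < p ^ j" "p ^ j < 1" "p ^ j \<le> p"
      using p power_decreasing[of 1 j p] by (auto simp: power_less_one_iff)
    have "ln (1 / (1 - p ^ j)) \<le> 1 / (1 - p ^ j) - 1" using q by (intro ln_le_minus_one) auto
    also have "\<dots> = p ^ j / (1 - p ^ j)" using q by (simp add: field_simps)
    also have "\<dots> \<le> p ^ j / (1 - p)" using q p by (intro divide_left_mono) auto
    finally have "- ln (1 - p ^ j) \<le> p ^ j / (1 - p)" using q by (simp add: ln_div)
    then have "m j * - ln (1 - p ^ j) \<le> m j * (p ^ j / (1 - p))"
      using m_pos[OF j] by (intro mult_left_mono) auto
    then show "exp (- (m j * p ^ j / (1 - p))) \<le> (1 - p ^ j) powr m j"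
      using q by (simp add: powr_def)
  qed simp
  have "0 \<le> p ^ n * fps_nth (tail_fps m 0) n" using p total_pos[of n] by simp
  with WE have "exp (- E) * (p ^ n * fps_nth (tail_fps m 0) n) \<le> W * (p ^ n * fps_nth (tail_fps m 0) n)"
    by (rule mult_right_mono)
  also have "\<dots> \<le> 1" using W1 by (simp add: mult.assoc)
  finally show ?thesis
    unfolding E_def[symmetric] by (simp only: exp_minus inverse_eq_divide) (simp add: mult.commute)
qed

end

section \<open>Criteria for convergence and divergence of the process\<close>

text \<open>By \<open>pmf_initial_multiset\<close> each mass is a constant times a tail quotient and
  a shift quotient of c, with limits given by \<open>tail_fps_ratio\<close> and \<rho>^s. Their
  product is the mass under independent laws \<open>NB_pmf (m j) (\<rho> ^ j)\<close>.\<close>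

lemma convergent_multiset_process:
  assumes \<rho>: "0 < \<rho>" "\<rho> < 1" and p: "0 < p" "p < 1"
    and lim: "(\<lambda>n. fps_nth (tail_fps m 0) n / fps_nth (tail_fps m 0) (Suc n)) \<longlonglongrightarrow> \<rho>"
  shows "convergent_structure (multiset_process m p)"
proof (rule convergent_structureI)
  fix l :: nat and x :: "nat \<Rightarrow> nat"
  define c where "c = fps_nth (tail_fps m 0)"
  have c_pos: "c n > 0" for n unfolding c_def by (rule total_pos)
  define Q where "Q = Pi_pmf {1..l} 0 (\<lambda>j. NB_pmf (m j) (\<rho> ^ j))"
  show "(\<lambda>n. pmf (initial_pmf l (multiset_process m p n)) x) \<longlonglongrightarrow> pmf Q x"
  proof (cases "\<forall>j. j \<notin> {1..l} \<longrightarrow> x j = 0")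
    case False
    have "x \<notin> set_pmf (initial_pmf l (multiset_process m p n))" for n
      using False by (auto simp: initial_pmf_def)
    then have "pmf (initial_pmf l (multiset_process m p n)) x = 0" for n by (simp add: set_pmf_iff)
    moreover have "pmf Q x = 0" unfolding Q_def using False by (intro pmf_Pi_outside) auto
    ultimately show ?thesis by simp
  next
    case True
    define s where "s = (\<Sum>j=1..l. j * x j)"
    define G where "G = (\<Prod>j=1..l. (m j + real (x j) - 1) gchoose x j)"
    define A where "A = (\<Prod>j=1..l. (1 - \<rho> ^ j) powr m j)"
    have "pmf Q x = (\<Prod>j=1..l. pmf (NB_pmf (m j) (\<rho> ^ j)) (x j))"
      unfolding Q_def using True by (subst pmf_Pi') auto
    also have "\<dots> = (\<Prod>j=1..l. (1 - \<rho> ^ j) powr m j * ((m j + real (x j) - 1) gchoose x j) * \<rho> ^ (j * x j))"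
      by (intro prod.cong refl pmf_Z[OF \<rho>]) auto
    also have "\<dots> = G * (A * \<rho> ^ s)"
      by (simp add: prod.distrib A_def G_def s_def power_sum)
    finally have Qx: "pmf Q x = G * (A * \<rho> ^ s)" .
    have pow: "(\<lambda>n. c n / c (n + s)) \<longlonglongrightarrow> \<rho> ^ s"
    proof (induction s)
      case 0
      show ?case using c_pos by (simp add: less_imp_neq[symmetric])
    next
      case (Suc s)
      have "(\<lambda>n. c n / c (n + s) * (c (n + s) / c (Suc (n + s)))) \<longlonglongrightarrow> \<rho> ^ s * \<rho>"
        by (intro tendsto_mult Suc) (use LIMSEQ_ignore_initial_segment[OF lim, of s] in \<open>simp add: c_def\<close>)
      moreover have "c n / c (n + s) * (c (n + s) / c (Suc (n + s))) = c n / c (n + Suc s)" for n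
        using c_pos[of "n + s"] by simp
      ultimately show ?case by (simp only: power_Suc mult.commute[of \<rho>])
    qed
    \<comment> \<open>The index is advanced by s, so that the natural-number subtraction of s
      disappears; \<open>LIMSEQ_offset\<close> undoes this at the end.\<close>
    have "(\<lambda>n. G * (fps_nth (tail_fps m l) n / c n * (c n / c (n + s)))) \<longlonglongrightarrow> G * (A * \<rho> ^ s)"
      unfolding A_def c_def
      by (intro tendsto_mult tendsto_const tail_fps_ratio[OF \<rho> total_pos lim] pow[unfolded c_def])
    moreover have "\<forall>\<^sub>F n in sequentially. G * (fps_nth (tail_fps m l) n / c n * (c n / c (n + s))) =
        pmf (initial_pmf l (multiset_process m p (n + s))) x"
      using eventually_ge_at_top[of l]
    proof eventually_elim
      case (elim n)
      have "pmf (initial_pmf l (multiset_process m p (n + s))) x =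
          (if s \<le> n + s then G * fps_nth (tail_fps m l) (n + s - s) / c (n + s) else 0)"
        unfolding G_def c_def s_def
        by (rule pmf_initial_multiset[OF p]) (use elim True in auto)
      then show ?case using c_pos[of n] by simp
    qed
    ultimately have "(\<lambda>n. pmf (initial_pmf l (multiset_process m p (n + s))) x) \<longlonglongrightarrow> G * (A * \<rho> ^ s)"
      by (rule Lim_transform_eventually)
    then show ?thesis unfolding Qx by (rule LIMSEQ_offset)
  qed
qed

text \<open>If the first component were tight, more than half of c q would come from the last M + 1
  coefficients of tail 1, so their partial sums D would grow by a fixed factor over every late
  window of length M + 1. As D n \<le> c n, this contradicts the bound c n x^n \<le> C for x close
  to 1.\<close>

lemma divergent_multiset_process:
  assumes p: "0 < p" "p < 1"
    and sm: "\<And>x. 0 < x \<Longrightarrow> x < 1 \<Longrightarrow> summable (\<lambda>j. m (Suc j) * x ^ Suc j)"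
  shows "divergent_structure (multiset_process m p)"
  unfolding divergent_structure_def
proof
  assume "convergent_structure (multiset_process m p)"
  then obtain M where "\<forall>\<^sub>F n in sequentially. measure_pmf.prob (multiset_process m p n) {k. k 1 > M} < 1 / 2"
    using convergent_structure_tight by blast
  then obtain N where N: "\<And>n. n \<ge> N \<Longrightarrow> measure_pmf.prob (multiset_process m p n) {k. k 1 > M} < 1 / 2"
    by (auto simp: eventually_sequentially)
  define c d where "c = fps_nth (tail_fps m 0)" and "d = fps_nth (tail_fps m 1)"
  define D where "D = (\<lambda>n. \<Sum>i\<le>n. d i)"
  define g where "g = (\<lambda>i. (m 1 + real i - 1) gchoose i)"
  have c_pos: "c n > 0" for n unfolding c_def by (rule total_pos)
  have d_nonneg: "d n \<ge> 0" for n unfolding d_def by (rule tail_nonneg)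
  have g_ge_1: "g i \<ge> 1" for i unfolding g_def by (intro nb_coeff_ge_1 m_ge_1) simp
  have c_conv: "c n = (\<Sum>i\<le>n. g i * d (n - i))" for n
    unfolding c_def d_def
    by (subst tail_fps_step) (simp add: fps_mult_nth nth_nb_fps g_def atMost_atLeast0)
  have D_rev: "(\<Sum>i\<le>n. d (n - i)) = D n" for n
    unfolding D_def by (rule sum.reindex_bij_witness[of _ "\<lambda>i. n - i" "\<lambda>i. n - i"]) auto
  \<comment> \<open>m 1 \<ge> 1 makes each \<open>g i\<close> at least 1, so the partial sums of d
    are dominated by c.\<close>
  have "1 * d (n - i) \<le> g i * d (n - i)" for n i
    using g_ge_1 d_nonneg by (rule mult_right_mono)
  then have D_le: "D n \<le> c n" for n
    unfolding c_conv D_rev[symmetric] by (intro sum_mono) simp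
  have D_ge: "D n \<ge> 1" for n
  proof -
    have "d 0 \<le> D n" unfolding D_def using d_nonneg by (intro member_le_sum) auto
    then show ?thesis by (simp add: d_def tail_fps_def)
  qed

  define B where "B = Max (g ` {..M})"
  have B: "g i \<le> B" if "i \<le> M" for i unfolding B_def using that by (intro Max_ge) auto
  have B1: "B \<ge> 1" using B[of 0] g_ge_1[of 0] by linarith
  define T where "T = Suc M"
  \<comment> \<open>The estimate D q < 2 B (D q - D n) below says that a share of more than 1 / (2
    B) of D q lies in the last window.\<close>
  define \<delta> where "\<delta> = 1 / (2 * B)"
  have \<delta>: "0 < \<delta>" "\<delta> \<le> 1 / 2" using B1 by (auto simp: \<delta>_def field_simps)
  have grow: "D n \<le> (1 - \<delta>) * D (n + T)" if "n \<ge> N" for n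
  proof -
    define q where "q = n + T"
    have q: "q \<ge> N" "M < q" "1 \<le> q" using that by (auto simp: q_def T_def)
    let ?K = "multiset_process m p q"
    have pmf1: "measure ?K {k. k 1 = i} = g i * d (q - i) / c q" if "i \<le> M" for i
    proof -
      define x where "x = (\<lambda>j :: nat. if j = 1 then i else 0)"
      have "(\<lambda>j. if j \<in> {1..1} then k j else 0) = x \<longleftrightarrow> k 1 = i" for k :: "nat \<Rightarrow> nat"
      proof
        assume eq: "(\<lambda>j. if j \<in> {1..1} then k j else 0) = x"
        from fun_cong[OF eq, of 1] show "k 1 = i" by (simp add: x_def)
      qed (auto simp: x_def fun_eq_iff)
      then have "pmf (initial_pmf 1 ?K) x = measure ?K {k. k 1 = i}"
        by (simp add: initial_pmf_def pmf_map vimage_def)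
      moreover have "pmf (initial_pmf 1 ?K) x = (if (\<Sum>j=1..1. j * x j) \<le> q
          then (\<Prod>j=1..1. (m j + real (x j) - 1) gchoose x j) *
            fps_nth (tail_fps m 1) (q - (\<Sum>j=1..1. j * x j)) / fps_nth (tail_fps m 0) q else 0)"
        by (rule pmf_initial_multiset[OF p]) (use q in \<open>auto simp: x_def\<close>)
      ultimately show ?thesis using that q by (simp add: x_def g_def d_def c_def)
    qed
    have "1 / 2 < 1 - measure ?K {k. k 1 > M}" using N[OF q(1)] by simp
    also have "\<dots> = measure ?K {k. k 1 \<le> M}"
    proof -
      have "{k :: nat \<Rightarrow> nat. k 1 \<le> M} = space (measure_pmf ?K) - {k. k 1 > M}" by auto
      then show ?thesis by (simp only: measure_pmf.prob_compl[of "{k. k 1 > M}" ?K] sets_measure_pmf UNIV_I)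
    qed
    also have "{k :: nat \<Rightarrow> nat. k 1 \<le> M} = (\<Union>i\<le>M. {k. k 1 = i})" by auto
    also have "measure ?K \<dots> = (\<Sum>i\<le>M. measure ?K {k. k 1 = i})"
      by (intro measure_pmf.finite_measure_finite_Union) (auto simp: disjoint_family_on_def)
    also have "\<dots> = (\<Sum>i\<le>M. g i * d (q - i)) / c q" 
      unfolding sum_divide_distrib by (intro sum.cong refl pmf1) simp
    finally have "c q / 2 < (\<Sum>i\<le>M. g i * d (q - i))" using c_pos[of q] by (simp add: field_simps)
    also have "\<dots> \<le> (\<Sum>i\<le>M. B * d (q - i))"
      using B d_nonneg by (intro sum_mono mult_right_mono) auto
    also have "\<dots> = B * (\<Sum>i\<le>M. d (q - i))" by (simp add: sum_distrib_left)
    \<comment> \<open>The window n < i \<le> q has exactly T = M + 1 elements.\<close>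
    also have "(\<Sum>i\<le>M. d (q - i)) = (\<Sum>i\<in>{n<..q}. d i)"
      by (rule sum.reindex_bij_witness[of _ "\<lambda>i. q - i" "\<lambda>i. q - i"]) (auto simp: q_def T_def)
    also have "\<dots> = D q - D n"
    proof -
      have "{..q} = {..n} \<union> {n<..q}" by (auto simp: q_def)
      then have "D q = D n + (\<Sum>i\<in>{n<..q}. d i)"
        unfolding D_def by (simp only:) (rule sum.union_disjoint, auto)
      then show ?thesis by simp
    qed
    finally have "c q / 2 < B * (D q - D n)" .
    then have "D q < 2 * B * (D q - D n)" using D_le[of q] by linarith
    then have "\<delta> * D q \<le> D q - D n" using B1 by (simp add: \<delta>_def field_simps)
    then show ?thesis by (simp add: q_def algebra_simps)
  qed
  have grow_pow: "D N \<le> (1 - \<delta>) ^ i * D (N + i * T)" for i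
  proof (induction i)
    case (Suc i)
    have "D N \<le> (1 - \<delta>) ^ i * D (N + i * T)" by fact
    also have "\<dots> \<le> (1 - \<delta>) ^ i * ((1 - \<delta>) * D (N + i * T + T))"
      using \<delta> by (intro mult_left_mono grow) auto
    finally show ?case by (simp add: mult_ac add_ac)
  qed simp

  \<comment> \<open>D grows at least by the factor 1 / (1 - \<delta>) per T steps. With x^T = 1 -
    \<delta> / 2 one keeps x < 1 while D n x^n is still unbounded.\<close>
  define x where "x = (1 - \<delta> / 2) powr (1 / real T)"
  have "ln (1 - \<delta> / 2) < 0" using \<delta> by simp
  then have x: "0 < x" "x < 1" using \<delta> by (auto simp: x_def powr_def T_def divide_neg_pos)
  have "x ^ T = x powr real T" using x by (simp add: powr_realpow)
  also have "\<dots> = 1 - \<delta> / 2"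
    unfolding x_def powr_powr using \<delta> by (simp add: T_def del: of_nat_Suc)
  finally have xT: "x ^ T = 1 - \<delta> / 2" .
  define C where "C = exp ((\<Sum>j. m (Suc j) * x ^ Suc j) / (1 - x))"
  have c_le: "c n * x ^ n \<le> C" for n
  proof -
    have "(\<Sum>j=1..n. m j * x ^ j) = (\<Sum>j<n. m (Suc j) * x ^ Suc j)"
      by (rule sum.reindex_bij_witness[of _ Suc "\<lambda>j. j - 1"]) auto
    also have "\<dots> \<le> (\<Sum>j. m (Suc j) * x ^ Suc j)"
      using x by (intro sum_le_suminf sm) (auto intro!: mult_nonneg_nonneg less_imp_le[OF m_pos])
    finally have "(\<Sum>j=1..n. m j * x ^ j) / (1 - x) \<le> (\<Sum>j. m (Suc j) * x ^ Suc j) / (1 - x)"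
      using x by (intro divide_right_mono) auto
    then have "exp (\<Sum>j=1..n. m j * x ^ j / (1 - x)) \<le> C"
      by (simp add: C_def sum_divide_distrib)
    then show ?thesis using total_power_le[OF x, of n] by (simp add: c_def)
  qed
  \<comment> \<open>Letting i tend to infinity in x^N \<le> C r^i will force x^N \<le> 0.\<close>
  define r where "r = (1 - \<delta>) / (1 - \<delta> / 2)"
  have r: "0 \<le> r" "r < 1" using \<delta> by (auto simp: r_def field_simps)
  have "x ^ N \<le> C * r ^ i" for i
  proof -
    have "x ^ N * (1 - \<delta> / 2) ^ i = x ^ (N + i * T)"
      by (simp add: power_add xT[symmetric] power_mult[symmetric] mult.commute)
    moreover have "1 * x ^ (N + i * T) \<le> (1 - \<delta>) ^ i * C"
    proof -
      have "1 * x ^ (N + i * T) \<le> ((1 - \<delta>) ^ i * D (N + i * T)) * x ^ (N + i * T)"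
        using x grow_pow[of i] D_ge[of N] by (intro mult_right_mono) auto
      also have "\<dots> \<le> ((1 - \<delta>) ^ i * c (N + i * T)) * x ^ (N + i * T)"
        using x \<delta> D_le by (intro mult_right_mono mult_left_mono) auto
      also have "\<dots> \<le> (1 - \<delta>) ^ i * C"
        using \<delta> c_le[of "N + i * T"] by (simp add: mult.assoc mult_left_mono)
      finally show ?thesis .
    qed
    ultimately have "x ^ N * (1 - \<delta> / 2) ^ i \<le> (1 - \<delta>) ^ i * C" by simp
    then show ?thesis using \<delta> by (simp add: r_def power_divide pos_le_divide_eq mult.commute)
  qed
  moreover have "(\<lambda>i. C * r ^ i) \<longlonglongrightarrow> C * 0"
    by (intro tendsto_intros LIMSEQ_power_zero) (use r in auto)
  ultimately have "x ^ N \<le> C * 0" by (intro LIMSEQ_le_const) auto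
  then show False using zero_less_power[OF x(1), of N] by simp
qed

end

section \<open>Growth conditions on the parameters\<close>

text \<open>Ratio test with a z strictly between x and 1. It serves case (i) with f = m and case
  (ii) with f j = j^\<alpha>.\<close>

lemma summable_power_of_ratio_1:
  fixes f :: "nat \<Rightarrow> real"
  assumes pos: "\<And>j. j \<ge> 1 \<Longrightarrow> f j > 0" and lim: "(\<lambda>j. f j / f (Suc j)) \<longlonglongrightarrow> 1"
    and x: "0 < x" "x < 1"
  shows "summable (\<lambda>j. f (Suc j) * x ^ Suc j)"
proof -
  obtain z where z: "x < z" "z < 1" using dense x by blast
  have "\<forall>\<^sub>F j in sequentially. f j / f (Suc j) > x / z"
    using z x by (intro order_tendstoD(1)[OF lim]) auto
  then obtain N where N: "\<And>j. j \<ge> N \<Longrightarrow> f j / f (Suc j) > x / z" by (auto simp: eventually_sequentially)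
  show ?thesis
  proof (rule summable_ratio_test[OF z(2)])
    fix j assume "j \<ge> N"
    then have "x * f (Suc (Suc j)) \<le> z * f (Suc j)"
      using N[of "Suc j"] pos[of "Suc (Suc j)"] z x by (simp add: field_simps)
    then have "x * f (Suc (Suc j)) * x ^ Suc j \<le> z * f (Suc j) * x ^ Suc j"
      using x by (intro mult_right_mono) auto
    then show "norm (f (Suc (Suc j)) * x ^ Suc (Suc j)) \<le> z * norm (f (Suc j) * x ^ Suc j)"
      using pos[of "Suc j"] pos[of "Suc (Suc j)"] x by (simp add: abs_mult mult_ac)
  qed
qed

context multiset_parameters
begin

text \<open>Scaling b k by \<rho>^k brings the ratio limit to the normal form 1; the two quotients
  are reciprocal up to the factor \<rho>.\<close>

lemma convergent_multiset_process':
  assumes \<rho>: "0 < \<rho>" "\<rho> < 1" and p: "0 < p" "p < 1"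
    and lim: "(\<lambda>n. euler_coeff (\<lambda>k. divisor_sum m k * \<rho> ^ k) (Suc n) /
      euler_coeff (\<lambda>k. divisor_sum m k * \<rho> ^ k) n) \<longlonglongrightarrow> 1"
  shows "convergent_structure (multiset_process m p)"
proof (rule convergent_multiset_process[OF \<rho> p])
  have "(\<lambda>n. \<rho> * inverse (euler_coeff (\<lambda>k. divisor_sum m k * \<rho> ^ k) (Suc n) /
      euler_coeff (\<lambda>k. divisor_sum m k * \<rho> ^ k) n)) \<longlonglongrightarrow> \<rho> * inverse 1"
    by (intro tendsto_intros lim) auto
  then show "(\<lambda>n. fps_nth (tail_fps m 0) n / fps_nth (tail_fps m 0) (Suc n)) \<longlonglongrightarrow> \<rho>"
    using \<rho> by (simp add: euler_coeff_scale tail_fps_0_eq_euler_coeff)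
qed

text \<open>The divisor d = k dominates: any other divisor is at most k / 2, where m d \<le> C
  \<sigma>^(k - d) m k is exponentially smaller than m k.\<close>

lemma divisor_sum_asymp:
  assumes lim: "(\<lambda>k. m k / m (Suc k)) \<longlonglongrightarrow> \<rho>" and \<rho>: "\<rho> < 1"
  shows "(\<lambda>k. divisor_sum m k / (real k * m k)) \<longlonglongrightarrow> 1"
proof -
  \<comment> \<open>The maximum with 0 makes \<sigma> positive, as
    \<open>ratio_geometric_bound\<close> requires.\<close>
  obtain \<sigma> where \<sigma>: "max 0 \<rho> < \<sigma>" "\<sigma> < 1" using dense[of "max 0 \<rho>" 1] \<rho> by auto
  have pos: "\<forall>\<^sub>F k in sequentially. m k > 0"
    using eventually_ge_at_top[of 1] by eventually_elim (rule m_pos)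
  obtain C N where C: "C > 0"
    and bound: "\<And>n k. n \<ge> N \<Longrightarrow> k \<le> n \<Longrightarrow> \<bar>m (n - k) / m n\<bar> \<le> C * \<sigma> ^ k"
    using ratio_geometric_bound[OF pos lim, of \<sigma>] \<sigma> by (metis less_imp_le max_less_iff_conj)
  have "(\<lambda>k. divisor_sum m k / (real k * m k) - 1) \<longlonglongrightarrow> 0"
  proof (rule tendsto_sandwich[where f = "\<lambda>_. 0"])
    have "(\<lambda>n. C * (real n * \<sigma> ^ n)) \<longlonglongrightarrow> C * 0"
      using \<sigma> by (intro tendsto_intros powser_times_n_limit_0) auto
    then show "(\<lambda>k. C * (real (k div 2) * \<sigma> ^ (k div 2))) \<longlonglongrightarrow> 0"
      using filterlim_compose[OF _ filterlim_at_top_div_const_nat[of 2]] by fastforce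
    show "\<forall>\<^sub>F k in sequentially. 0 \<le> divisor_sum m k / (real k * m k) - 1"
      using eventually_ge_at_top[of 1]
    proof eventually_elim
      case (elim k)
      then show ?case using divisor_sum_ge[OF elim] m_pos[OF elim] by simp
    qed
    show "\<forall>\<^sub>F k in sequentially. divisor_sum m k / (real k * m k) - 1 \<le>
        C * (real (k div 2) * \<sigma> ^ (k div 2))"
      using eventually_ge_at_top[of "max 1 N"]
    proof eventually_elim
      case (elim k)
      then have k: "k \<ge> 1" "k \<ge> N" by auto
      have fin: "finite {d. d dvd k}" using k by simp
      have sub: "{d. d dvd k} - {k} \<subseteq> {1..k div 2}"
      proof
        fix d assume d: "d \<in> {d. d dvd k} - {k}"
        then obtain e where e: "k = d * e" by auto
        with d k have "d \<ge> 1" "e \<noteq> 0" "e \<noteq> 1" by (auto intro: Suc_leI gr0I)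
        then have "d * 2 \<le> d * e" by (intro mult_le_mono2) auto
        then have "d * 2 \<le> k" unfolding e .
        then show "d \<in> {1..k div 2}" using \<open>d \<ge> 1\<close> by (simp add: less_eq_div_iff_mult_less_eq)
      qed
      have "divisor_sum m k = real k * m k + (\<Sum>d\<in>{d. d dvd k} - {k}. real d * m d)"
        
        unfolding divisor_sum_def by (rule sum.remove[OF fin]) simp
      also have "(\<Sum>d\<in>{d. d dvd k} - {k}. real d * m d) \<le> (\<Sum>d=1..k div 2. real d * m d)"
        using sub by (intro sum_mono2) (auto intro!: mult_nonneg_nonneg less_imp_le[OF m_pos])
      \<comment> \<open>Crude bounds suffice: d \<le> k, k div 2 summands, and \<sigma>^(k - d)
        \<le> \<sigma>^(k div 2).\<close>
      also have "\<dots> \<le> (\<Sum>d=1..k div 2. real k * (C * \<sigma> ^ (k div 2) * m k))"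
      proof (intro sum_mono mult_mono)
        fix d assume d: "d \<in> {1..k div 2}"
        then have "k - (k - d) = d" by auto
        then have "m d / m k \<le> C * \<sigma> ^ (k - d)" 
          using abs_ge_self[of "m d / m k"] bound[OF k(2), of "k - d"] by simp
        also have "\<dots> \<le> C * \<sigma> ^ (k div 2)"
          using C \<sigma> d by (intro mult_left_mono power_decreasing) auto
        finally show "m d \<le> C * \<sigma> ^ (k div 2) * m k" using m_pos[OF k(1)] by (simp add: pos_divide_le_eq)
      qed (use m_pos in \<open>auto simp: less_imp_le\<close>)
      also have "\<dots> = (C * (real (k div 2) * \<sigma> ^ (k div 2))) * (real k * m k)" by simp
      finally have "divisor_sum m k \<le> (1 + C * (real (k div 2) * \<sigma> ^ (k div 2))) * (real k * m k)"
        by (simp add: algebra_simps)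
      moreover have "real k * m k > 0" using k m_pos[OF k(1)] by simp
      ultimately have "divisor_sum m k / (real k * m k) \<le> 1 + C * (real (k div 2) * \<sigma> ^ (k div 2))"
        by (simp only: pos_divide_le_eq)
      then show ?case by simp
    qed
  qed auto
  then show ?thesis by (simp add: LIM_zero_iff)
qed

section \<open>Convergence in cases (iv) to (vi)\<close>

text \<open>By \<open>divisor_sum_asymp\<close> the scaled divisor sum behaves like k m k \<rho>^k,
  whose successive quotients tend to 1 because m (k + 1) / m k tends to 1 / \<rho>.\<close>

lemma convergent_of_RT:
  assumes lim: "(\<lambda>k. m k / m (Suc k)) \<longlonglongrightarrow> \<rho>" and \<rho>: "0 < \<rho>" "\<rho> < 1" and p: "0 < p" "p < 1"
  shows "convergent_structure (multiset_process m p)"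
proof (rule convergent_multiset_process'[OF \<rho> p], rule euler_coeff_ratio_tendsto_1)
  show "divisor_sum m k * \<rho> ^ k > 0" if "k \<ge> 1" for k
    using divisor_sum_pos[OF that] \<rho> by simp
  define q where "q = (\<lambda>k. divisor_sum m k / (real k * m k))"
  have q: "q \<longlonglongrightarrow> 1" unfolding q_def by (rule divisor_sum_asymp[OF lim \<rho>(2)])
  have "(\<lambda>k. q (Suc k) / q k * (real (Suc k) / real k) * (\<rho> * inverse (m k / m (Suc k)))) \<longlonglongrightarrow>
      1 / 1 * 1 * (\<rho> * inverse \<rho>)"
    using \<rho> by (intro tendsto_intros LIMSEQ_Suc[OF q] q lim) (auto, real_asymp)
  moreover have "\<forall>\<^sub>F k in sequentially. q (Suc k) / q k * (real (Suc k) / real k) * (\<rho> * inverse (m k / m (Suc k))) =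
      divisor_sum m (Suc k) * \<rho> ^ Suc k / (divisor_sum m k * \<rho> ^ k)"
    using eventually_ge_at_top[of 1]
  proof eventually_elim
    case (elim k)
    then show ?case using m_pos[of k] m_pos[of "Suc k"] divisor_sum_pos[of k] \<rho>
      by (simp add: q_def field_simps del: of_nat_Suc)
  qed
  ultimately show "(\<lambda>k. divisor_sum m (Suc k) * \<rho> ^ Suc k / (divisor_sum m k * \<rho> ^ k)) \<longlonglongrightarrow> 1"
    using \<rho> by (simp add: tendsto_cong)
qed

text \<open>After scaling by y^(-k) the divisor d contributes at most \<gamma> k^r y^(d - k);
  summing over all d \<le> k leaves a geometric series.\<close>

lemma divisor_sum_scaled_le:
  assumes r: "r \<ge> 0" and y: "y > 1" and \<gamma>: "\<gamma> > 0"
    and ub: "\<And>j. j \<ge> 1 \<Longrightarrow> m j \<le> \<gamma> * y ^ j * real j powr (r - 1)" and k: "k \<ge> 1"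
  shows "divisor_sum m k * (1 / y) ^ k \<le> \<gamma> / (1 - 1 / y) * real k powr r"
proof -
  define \<rho> where "\<rho> = 1 / y"
  have \<rho>: "0 < \<rho>" "\<rho> < 1" using y by (auto simp: \<rho>_def)
  have term_le: "real d * m d * \<rho> ^ k \<le> \<gamma> * real k powr r * \<rho> ^ (k - d)" if "d \<in> {1..k}" for d
  proof -
    have "real d * m d * \<rho> ^ k \<le> real d * (\<gamma> * y ^ d * real d powr (r - 1)) * \<rho> ^ k"
      using ub[of d] that \<rho> by (intro mult_right_mono mult_left_mono) auto
    also have "\<dots> = \<gamma> * (real d * real d powr (r - 1)) * (y ^ d * \<rho> ^ k)" by simp
    also have "real d * real d powr (r - 1) = real d powr r"
      using that by (simp add: powr_mult_base)
    also have "y ^ d * \<rho> ^ k = \<rho> ^ (k - d)"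
      using that y by (simp add: \<rho>_def power_one_over power_diff)
    also have "\<gamma> * real d powr r * \<rho> ^ (k - d) \<le> \<gamma> * real k powr r * \<rho> ^ (k - d)"
      using that r \<rho> \<gamma> by (intro mult_right_mono mult_left_mono powr_mono2) auto
    finally show ?thesis .
  qed
  have "divisor_sum m k * \<rho> ^ k \<le> (\<Sum>d=1..k. real d * m d * \<rho> ^ k)"
    unfolding divisor_sum_def sum_distrib_right using k \<rho>
    by (intro sum_mono2) (auto intro!: mult_nonneg_nonneg less_imp_le[OF m_pos] Suc_leI intro: dvd_imp_le dvd_pos_nat)
  also have "\<dots> \<le> (\<Sum>d=1..k. \<gamma> * real k powr r * \<rho> ^ (k - d))" by (intro sum_mono term_le)
  also have "\<dots> = \<gamma> * real k powr r * (\<Sum>i<k. \<rho> ^ i)"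
    unfolding sum_distrib_left
    by (rule sum.reindex_bij_witness[of _ "\<lambda>i. k - i" "\<lambda>i. k - i"]) auto
  also have "\<dots> \<le> \<gamma> * real k powr r * (1 / (1 - \<rho>))"
  proof (intro mult_left_mono)
    have "(\<Sum>i<k. \<rho> ^ i) = (1 - \<rho> ^ k) / (1 - \<rho>)" using \<rho> by (simp add: sum_gp_strict)
    also have "\<dots> \<le> 1 / (1 - \<rho>)" using \<rho> by (intro divide_right_mono) auto
    finally show "(\<Sum>i<k. \<rho> ^ i) \<le> 1 / (1 - \<rho>)" .
  qed (use \<gamma> in auto)
  finally show ?thesis by (simp add: \<rho>_def)
qed

text \<open>Common frame for (v) and (vi), with \<rho> = 1 / y. The minorant b is placed below the
  term d = k of the scaled divisor sum, and \<open>small\<close> compares the upper bound k^r from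
  \<open>divisor_sum_scaled_le\<close> with the growth generated by b.\<close>

lemma convergent_of_minorant:
  assumes r: "r \<ge> 0" and y: "y > 1" and \<gamma>: "\<gamma> > 0" and p: "0 < p" "p < 1"
    and ub: "\<And>j. j \<ge> 1 \<Longrightarrow> m j \<le> \<gamma> * y ^ j * real j powr (r - 1)"
    and b_pos: "\<And>k. k \<ge> 1 \<Longrightarrow> b k > 0"
    and b_le: "\<And>k. k \<ge> 1 \<Longrightarrow> b k \<le> real k * m k * (1 / y) ^ k"
    and b_ratio: "(\<lambda>k. b (Suc k) / b k) \<longlonglongrightarrow> 1"
    and small: "(\<lambda>n. real (Suc n) powr r / (real (Suc n) * euler_coeff b n)) \<longlonglongrightarrow> 0"
  shows "convergent_structure (multiset_process m p)"
proof (rule convergent_multiset_process'[OF _ _ p], rule_tac [3] euler_coeff_ratio_of_minorant[OF b_pos])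
  show "0 < 1 / y" "1 / y < 1" using y by auto
  show "b k \<le> divisor_sum m k * (1 / y) ^ k" if "k \<ge> 1" for k
    using y by (intro order_trans[OF b_le[OF that]] mult_right_mono divisor_sum_ge[OF that]) auto
  show "(\<lambda>n. euler_coeff b (Suc n) / euler_coeff b n) \<longlonglongrightarrow> 1"
    by (rule euler_coeff_ratio_tendsto_1[OF b_pos b_ratio])
  have e_pos: "euler_coeff b n > 0" for n by (rule euler_coeff_pos[OF b_pos])
  show "(\<lambda>n. divisor_sum m (Suc n) * (1 / y) ^ Suc n / (real (Suc n) * euler_coeff b n)) \<longlonglongrightarrow> 0"
  proof (rule tendsto_sandwich[where f = "\<lambda>_. 0"])
    show "(\<lambda>n. \<gamma> / (1 - 1 / y) * (real (Suc n) powr r / (real (Suc n) * euler_coeff b n))) \<longlonglongrightarrow> 0"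
      using tendsto_mult_left[OF small, of "\<gamma> / (1 - 1 / y)"] by simp
    show "\<forall>\<^sub>F n in sequentially. divisor_sum m (Suc n) * (1 / y) ^ Suc n / (real (Suc n) * euler_coeff b n)
        \<le> \<gamma> / (1 - 1 / y) * (real (Suc n) powr r / (real (Suc n) * euler_coeff b n))"
    proof (intro always_eventually allI)
      fix n
      have "divisor_sum m (Suc n) * (1 / y) ^ Suc n / (real (Suc n) * euler_coeff b n)
          \<le> (\<gamma> / (1 - 1 / y) * real (Suc n) powr r) / (real (Suc n) * euler_coeff b n)"
        using e_pos[of n] by (intro divide_right_mono divisor_sum_scaled_le[OF r y \<gamma> ub]) auto
      then show "divisor_sum m (Suc n) * (1 / y) ^ Suc n / (real (Suc n) * euler_coeff b n)
          \<le> \<gamma> / (1 - 1 / y) * (real (Suc n) powr r / (real (Suc n) * euler_coeff b n))" by simp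
    qed
    show "\<forall>\<^sub>F n in sequentially. 0 \<le> divisor_sum m (Suc n) * (1 / y) ^ Suc n / (real (Suc n) * euler_coeff b n)"
    proof (intro always_eventually allI)
      fix n
      show "0 \<le> divisor_sum m (Suc n) * (1 / y) ^ Suc n / (real (Suc n) * euler_coeff b n)"
        using e_pos[of n] divisor_sum_pos[of "Suc n"] y
        by (intro divide_nonneg_pos mult_nonneg_nonneg) auto
    qed
  qed auto
qed

text \<open>The minorant \<gamma>1 k^s tends to infinity, so by
  \<open>euler_coeff_superpolynomial\<close> it generates coefficients above a constant times
  n^r.\<close>

lemma convergent_of_polynomial_bounds:
  assumes s: "s > 0" and r: "r \<ge> 0" and y: "y > 1" and \<gamma>: "\<gamma>1 > 0" "\<gamma>2 > 0" and p: "0 < p" "p < 1"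
    and lb: "\<And>j. j \<ge> 1 \<Longrightarrow> \<gamma>1 * y ^ j * real j powr (s - 1) \<le> m j"
    and ub: "\<And>j. j \<ge> 1 \<Longrightarrow> m j \<le> \<gamma>2 * y ^ j * real j powr (r - 1)"
  shows "convergent_structure (multiset_process m p)"
proof (rule convergent_of_minorant[OF r y \<gamma>(2) p ub])
  define b where "b = (\<lambda>k. \<gamma>1 * real k powr s)"
  show b_pos: "b k > 0" if "k \<ge> 1" for k using that \<gamma> by (simp add: b_def)
  show "b k \<le> real k * m k * (1 / y) ^ k" if "k \<ge> 1" for k
  proof -
    have "b k = real k * (\<gamma>1 * y ^ k * real k powr (s - 1)) * (1 / y) ^ k"
      using that y by (simp add: b_def power_one_over powr_mult_base[of "real k" "s - 1", simplified, symmetric])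
    also have "\<dots> \<le> real k * m k * (1 / y) ^ k"
      using lb[OF that] y by (intro mult_right_mono mult_left_mono) auto
    finally show ?thesis .
  qed
  have "(\<lambda>k. real (Suc k) powr s / real k powr s) \<longlonglongrightarrow> 1" by real_asymp
  then show "(\<lambda>k. b (Suc k) / b k) \<longlonglongrightarrow> 1" using \<gamma> by (simp add: b_def)
  have "filterlim b at_top sequentially" unfolding b_def using s \<gamma>
    by (intro filterlim_tendsto_pos_mult_at_top[OF tendsto_const], simp, real_asymp)
  \<comment> \<open>An integer exponent that is at least r; the factor 1 / (n + 1) then provides the
    limit 0.\<close>
  from euler_coeff_superpolynomial[OF b_pos this, of "nat \<lceil>r\<rceil>"]
  obtain C where C: "C > 0" "\<And>n. C * real (Suc n) ^ nat \<lceil>r\<rceil> \<le> euler_coeff b n" by blast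
  have e_pos: "euler_coeff b n > 0" for n by (rule euler_coeff_pos[OF b_pos])
  show "(\<lambda>n. real (Suc n) powr r / (real (Suc n) * euler_coeff b n)) \<longlonglongrightarrow> 0"
  proof (rule tendsto_sandwich[where f = "\<lambda>_. 0"])
    show "(\<lambda>n. 1 / C * (1 / real (Suc n))) \<longlonglongrightarrow> 0"
      by (rule tendsto_mult_right_zero) real_asymp
    show "\<forall>\<^sub>F n in sequentially. real (Suc n) powr r / (real (Suc n) * euler_coeff b n) \<le> 1 / C * (1 / real (Suc n))"
    proof (intro always_eventually allI)
      fix n
      have "r \<le> real (nat \<lceil>r\<rceil>)" using r by linarith
      then have "real (Suc n) powr r \<le> real (Suc n) powr real (nat \<lceil>r\<rceil>)" by (intro powr_mono) auto
      also have "\<dots> = real (Suc n) ^ nat \<lceil>r\<rceil>" by (intro powr_realpow) simp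
      finally have "C * real (Suc n) powr r \<le> euler_coeff b n"
        using C(1) by (intro order_trans[OF mult_left_mono C(2)]) auto
      then have "real (Suc n) powr r / euler_coeff b n \<le> 1 / C"
        using C(1) e_pos[of n] by (simp add: field_simps)
      then have "real (Suc n) powr r / euler_coeff b n * (1 / real (Suc n)) \<le> 1 / C * (1 / real (Suc n))"
        by (intro mult_right_mono) auto
      then show "real (Suc n) powr r / (real (Suc n) * euler_coeff b n) \<le> 1 / C * (1 / real (Suc n))"
        by (simp add: mult.commute)
    qed
    show "\<forall>\<^sub>F n in sequentially. 0 \<le> real (Suc n) powr r / (real (Suc n) * euler_coeff b n)"
      using e_pos by (intro always_eventually allI divide_nonneg_pos) auto
  qed auto
qed

text \<open>The limiting case s = r = 0: the minorant is constant, the scaled divisor sum is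
  bounded, and n u n tends to infinity by
  \<open>euler_coeff_const_times_index_at_top\<close>.\<close>

lemma convergent_of_exponential_order:
  assumes y: "y > 1" and \<gamma>: "\<gamma>1 > 0" "\<gamma>2 > 0" and p: "0 < p" "p < 1"
    and lb: "\<And>j. j \<ge> 1 \<Longrightarrow> \<gamma>1 * (y ^ j / real j) \<le> m j"
    and ub: "\<And>j. j \<ge> 1 \<Longrightarrow> m j \<le> \<gamma>2 * (y ^ j / real j)"
  shows "convergent_structure (multiset_process m p)"
proof (rule convergent_of_minorant[where r = 0 and b = "\<lambda>_. \<gamma>1", OF _ y \<gamma>(2) p])
  show "m j \<le> \<gamma>2 * y ^ j * real j powr (0 - 1)" if "j \<ge> 1" for j
    using ub[OF that] that by (simp add: powr_minus divide_inverse mult.assoc)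
  show "\<gamma>1 \<le> real k * m k * (1 / y) ^ k" if "k \<ge> 1" for k
  proof -
    have "\<gamma>1 = real k * (\<gamma>1 * (y ^ k / real k)) * (1 / y) ^ k"
      using that y by (simp add: power_one_over)
    also have "\<dots> \<le> real k * m k * (1 / y) ^ k"
      using lb[OF that] y by (intro mult_right_mono mult_left_mono) auto
    finally show ?thesis .
  qed
  have "filterlim (\<lambda>n. real (Suc n) * euler_coeff (\<lambda>_. \<gamma>1) n) at_top sequentially"
  proof (rule filterlim_at_top_mono[OF euler_coeff_const_times_index_at_top[OF \<gamma>(1)]])
    show "\<forall>\<^sub>F n in sequentially. real n * euler_coeff (\<lambda>_. \<gamma>1) n \<le> real (Suc n) * euler_coeff (\<lambda>_. \<gamma>1) n"
      using \<gamma> by (intro always_eventually allI mult_right_mono euler_coeff_nonneg) auto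
  qed
  then have "(\<lambda>n. 1 / (real (Suc n) * euler_coeff (\<lambda>_. \<gamma>1) n)) \<longlonglongrightarrow> 0"
    by (intro real_tendsto_divide_at_top[OF tendsto_const])
  then show "(\<lambda>n. real (Suc n) powr 0 / (real (Suc n) * euler_coeff (\<lambda>_. \<gamma>1) n)) \<longlonglongrightarrow> 0" by simp
qed (use \<gamma> in auto)

section \<open>Divergence in cases (i) to (iii)\<close>

lemma divergent_of_RT:
  assumes "(\<lambda>k. m k / m (Suc k)) \<longlonglongrightarrow> 1" and "0 < p" "p < 1"
  shows "divergent_structure (multiset_process m p)"
  using assms by (intro divergent_multiset_process summable_power_of_ratio_1 m_pos)

lemma divergent_of_bigo:
  assumes "m \<in> O(\<lambda>j. real j powr \<alpha>)" and p: "0 < p" "p < 1"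
  shows "divergent_structure (multiset_process m p)"
proof (rule divergent_multiset_process[OF p])
  fix x :: real assume x: "0 < x" "x < 1"
  have sm: "summable (\<lambda>j. real (Suc j) powr \<alpha> * x ^ Suc j)"
  proof (rule summable_power_of_ratio_1[OF _ _ x])
    show "(\<lambda>j. real j powr \<alpha> / real (Suc j) powr \<alpha>) \<longlonglongrightarrow> 1" by real_asymp
  qed auto
  obtain C where "\<forall>\<^sub>F j in sequentially. norm (m j) \<le> C * norm (real j powr \<alpha>)"
    using assms(1) by (elim landau_o.bigE)
  then have "\<forall>\<^sub>F j in sequentially. norm (m (Suc j)) \<le> C * norm (real (Suc j) powr \<alpha>)"
    by (subst eventually_sequentially_Suc)
  then have "\<forall>\<^sub>F j in sequentially. norm (m (Suc j) * x ^ Suc j) \<le> C * (real (Suc j) powr \<alpha> * x ^ Suc j)"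
  proof eventually_elim
    case (elim j)
    have "norm (m (Suc j)) * x ^ Suc j \<le> C * norm (real (Suc j) powr \<alpha>) * x ^ Suc j"
      using elim x by (intro mult_right_mono) auto
    then show ?case using x by (simp add: abs_mult mult.assoc)
  qed
  then show "summable (\<lambda>j. m (Suc j) * x ^ Suc j)"
    by (rule summable_comparison_test_ev) (intro summable_mult sm)
qed

end

theorem corollary3:
  fixes m :: "nat \<Rightarrow> real"
  assumes "\<And>j. j \<ge> 1 \<Longrightarrow> m j \<ge> 1"
  shows
    "(m \<in> RT 1
      \<or> (\<exists>\<alpha>::real. m \<in> O(\<lambda>j. real j powr \<alpha>))
      \<or> (\<exists>r \<epsilon>. r > 0 \<and> 0 < \<epsilon> \<and> \<epsilon> \<le> r / 3 \<and> m \<in> \<F> (2 * r / 3 + \<epsilon>) r 1)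
      \<longrightarrow> (\<forall>p. 0 < p \<and> p < 1 \<longrightarrow> divergent_structure (multiset_process m p)))
     \<and>
     ((\<exists>\<rho>::real. 0 < \<rho> \<and> \<rho> < 1 \<and> m \<in> RT (ereal \<rho>))
      \<or> (\<exists>r \<epsilon> y. r > 0 \<and> 0 < \<epsilon> \<and> \<epsilon> \<le> r / 3 \<and> y > 1 \<and> m \<in> \<F> (2 * r / 3 + \<epsilon>) r y)
      \<or> (\<exists>y::real. y > 1 \<and> m \<asymp> (\<lambda>j. y ^ j / real j))
      \<longrightarrow> (\<forall>p. 0 < p \<and> p < 1 \<longrightarrow> convergent_structure (multiset_process m p)))"
proof (intro conjI impI allI; elim conjE)
  interpret multiset_parameters m by unfold_locales (rule assms)
  fix p :: real assume p: "0 < p" "p < 1"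
  assume "m \<in> RT 1 \<or> (\<exists>\<alpha>::real. m \<in> O(\<lambda>j. real j powr \<alpha>))
      \<or> (\<exists>r \<epsilon>. r > 0 \<and> 0 < \<epsilon> \<and> \<epsilon> \<le> r / 3 \<and> m \<in> \<F> (2 * r / 3 + \<epsilon>) r 1)"
  then consider (RT) "m \<in> RT 1" | (bigo) \<alpha> :: real where "m \<in> O(\<lambda>j. real j powr \<alpha>)"
    | (F) r \<epsilon> where "m \<in> \<F> (2 * r / 3 + \<epsilon>) r 1" by blast
  then show "divergent_structure (multiset_process m p)"
  proof cases
    case RT
    then show ?thesis using p by (intro divergent_of_RT) (auto simp: RT_def one_ereal_def)
  next
    case bigo
    then show ?thesis using p by (rule divergent_of_bigo)
  next
    case F
    then obtain \<gamma> where \<gamma>: "\<And>j. j \<ge> 1 \<Longrightarrow> m j \<le> \<gamma> * real j powr (r - 1)"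
      by (auto simp: \<F>_def)
    \<comment> \<open>For y = 1 the upper bound reads m j = O(j^(r - 1)), so (iii) reduces to
      (ii).\<close>
    have "m \<in> O(\<lambda>j. real j powr (r - 1))"
    proof (rule bigoI)
      show "\<forall>\<^sub>F j in sequentially. norm (m j) \<le> \<gamma> * norm (real j powr (r - 1))"
        using eventually_ge_at_top[of 1]
      proof eventually_elim
        case (elim j)
        then show ?case using \<gamma>[of j] m_pos[of j] by simp
      qed
    qed
    then show ?thesis using p by (rule divergent_of_bigo)
  qed
next
  interpret multiset_parameters m by unfold_locales (rule assms)
  fix p :: real assume p: "0 < p" "p < 1"
  assume "(\<exists>\<rho>::real. 0 < \<rho> \<and> \<rho> < 1 \<and> m \<in> RT (ereal \<rho>))
      \<or> (\<exists>r \<epsilon> y. r > 0 \<and> 0 < \<epsilon> \<and> \<epsilon> \<le> r / 3 \<and> y > 1 \<and> m \<in> \<F> (2 * r / 3 + \<epsilon>) r y)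
      \<or> (\<exists>y::real. y > 1 \<and> m \<asymp> (\<lambda>j. y ^ j / real j))"
  then consider (RT) \<rho> :: real where "0 < \<rho>" "\<rho> < 1" "m \<in> RT (ereal \<rho>)"
    | (F) r \<epsilon> y where "r > 0" "\<epsilon> > 0" "y > 1" "m \<in> \<F> (2 * r / 3 + \<epsilon>) r y"
    | (order) y :: real where "y > 1" "m \<asymp> (\<lambda>j. y ^ j / real j)" by blast
  then show "convergent_structure (multiset_process m p)"
  proof cases
    case RT
    then show ?thesis using p by (intro convergent_of_RT[of \<rho>]) (auto simp: RT_def)
  next
    case F
    from F(4) obtain \<gamma>1 \<gamma>2 where "\<gamma>1 > 0" "\<gamma>2 > 0"
      and "\<And>j. j \<ge> 1 \<Longrightarrow> \<gamma>1 * y ^ j * real j powr (2 * r / 3 + \<epsilon> - 1) \<le> m j"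
      and "\<And>j. j \<ge> 1 \<Longrightarrow> m j \<le> \<gamma>2 * y ^ j * real j powr (r - 1)"
      by (auto simp: \<F>_def)
    \<comment> \<open>The lower exponent s = 2 r / 3 + \<epsilon> is positive.\<close>
    then show ?thesis using F p by (intro convergent_of_polynomial_bounds[of "2 * r / 3 + \<epsilon>" r y \<gamma>1 \<gamma>2]) auto
  next
    case order
    from order(2) obtain c C where cC: "c > 0" "C > 0"
      "\<And>j. j \<ge> 1 \<Longrightarrow> c \<le> m j / (y ^ j / real j) \<and> m j / (y ^ j / real j) \<le> C"
      by (auto simp: same_order_def)
    have "0 < y ^ j / real j" if "j \<ge> 1" for j using order(1) that by simp
    then have "c * (y ^ j / real j) \<le> m j" "m j \<le> C * (y ^ j / real j)" if "j \<ge> 1" for j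
      using cC(3)[OF that] that by (simp_all only: pos_le_divide_eq pos_divide_le_eq)
    then show ?thesis using order(1) cC(1,2) p by (intro convergent_of_exponential_order[of y c C]) auto
  qed
qed

end
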